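(* For every $k\ge0$, with respect to the Virasoro module structure $L(1,k^2)$ on $\Pi_k$ transported by $\rho$, the Gelfand–Tsetlin basis of $\Pi_k$ (consisting of the infinite two-row Young tableaux $\tau$ tail-equivalent to $\tau_k$) is an eigenbasis of $L_0$, and the eigenvalues are given by the stable major index: $$L_0\tau=r(\tau)\,\tau\qquad\text{for all }\tau\in\mathcal T_k .$$
   Context: All spaces are over $\mathbb C$; $N=2n$ is even. $M_d$ is the $d$-dimensional irreducible $\mathfrak{sl}_2$-module with a fixed inner product for which it is unitary ($e^*=f$, $h^*=h$). Fusion product. Let $v_0$ be the lowest weight vector of $M_2=\mathbb C^2$ and $z_1,\dots,z_N$ pairwise distinct complex numbers. On $V_N=M_2(z_1)\otimes\cdots\otimes M_2(z_N)$, where $(x\otimes t^{-i})v=z^i\,xv$ on $M_2(z)$, put $e_{-j}=e\otimes t^{-j}$, $v_N=v_0^{\otimes N}$, and let $V_N^{(\le m)}$ be the span of all $e_{-i_1}\cdots e_{-i_l}v_N$ with $l\ge0$, $i_s\ge0$, $i_1+\dots+i_l\le m$. The fusion product is $V_N^*=\bigoplus_{m\ge0}V_N^*[-m]$, $V_N^*[-m]=V_N^{(\le m)}/V_N^{(\le m-1)}$ (elements of $V_N^*[-m]$ have $\widetilde{\deg}=-m$), a graded cyclic $\mathfrak{sl}_2\otimes\mathbb C[t^{-1}]$-module generated by $v_N$, independent of the $z_i$. Limit. It is known that there is an injective $\mathfrak{sl}_2\otimes\mathbb C[t^{-1}]$-equivariant map $j_N:V_N^*\to V_{N+2}^*$,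 $v_N\mapsto e_{-(N+1)}v_{N+2}$, and that $\mathcal V=\varinjlim(V_N^*,j_N)$ is isomorphic to the basic level 1 representation $L_{0,1}$ of $\widehat{\mathfrak{sl}}_2$, with convention $[x\otimes t^m,y\otimes t^l]=[x,y]\otimes t^{m+l}-m\,\delta_{m+l,0}\operatorname{tr}(xy)c$, $c=1$, and vacuum $v_{N=0}$ annihilated by $\mathfrak{sl}_2\otimes\mathbb C[t^{-1}]$. The homogeneous grading is $\deg v=n^2+\widetilde{\deg}(v)$ for $v\in V_{2n}^*$. $\mathcal V$ carries the positive definite Hermitian form with $(e\otimes t^m)^*=f\otimes t^{-m}$, $(h\otimes t^m)^*=h\otimes t^{-m}$, vacuum of norm 1, and $V_N^*$ carries its restriction. Tableaux. For a standard Young tableau $\tau$ with $N$ cells, $\operatorname{maj}(\tau)$ is the sum of all $i\le N-1$ such that $i+1$ lies in a lower row of $\tau$ than $i$. $\mathcal X_N=\bigoplus_{k=0}^nM_{2k+1}\otimes\pi_k$, where $\pi_k$ has orthonormal basis the standard Young tableaux of shape $(n+k,n-k)$; $i_N:\mathcal X_N\to\mathcal X_{N+2}$ sends $x\otimes\tau$ to $x\otimes\tau'$, $\tau'$ being $\tau$ with $N+1$ added to the first row and $N+2$ to the second row. Then $\mathcal X=\varinjlim(\mathcal X_N,i_N)=\bigoplus_{k\ge0}M_{2k+1}\otimes\Pi_k$, where $\Pi_k$ has orthonormal basis $\mathcal T_k$, the set of infinite two-row standard Young tableaux tail-equivalent to $\tau_k$ (differing from it in the row of only finitely many entries, with initial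 parts of length $2n$ of shape $(n+k,n-k)$ for large $n$); $\tau_k$ has first row $1,\dots,2k,2k+1,2k+3,\dots$ and second row $2k+2,2k+4,\dots$. For $\tau\in\mathcal T_k$, the stable major index is $r(\tau)=\lim_{n\to\infty}(n^2-\operatorname{maj}([\tau]_{2n}))$, where $[\tau]_l$ is the subtableau of entries $\le l$. The isomorphism $\rho$. Fix unitary $\mathfrak{sl}_2$-isomorphisms $\rho_N:V_N^*\to\mathcal X_N$ sending elements with $\widetilde{\deg}=-i$ into the span of the $x\otimes\tau$ with $\operatorname{maj}(\tau)=i$, and such that $\rho_{N+2}j_N=i_N\rho_N$ for all even $N$ (such families exist); let $\rho:\mathcal V\to\mathcal X$ be the limit isomorphism. Virasoro action. Put $a_m=\frac1{\sqrt2}\,h\otimes t^{-m}$, so $[a_m,a_l]=m\delta_{m,-l}$ on $\mathcal V$, and $L_m=\frac12\sum_{j\in\mathbb Z}a_{-j}a_{j+m}$ for $m\ne0$, $L_0=\frac12a_0^2+\sum_{j\ge1}a_{-j}a_j$. This is a representation of the Virasoro algebra with central charge 1 commuting with $\mathfrak{sl}_2$, and $\mathcal V\simeq\bigoplus_{k\ge0}M_{2k+1}\otimes L(1,k^2)$, where $L(1,k^2)$ is the irreducible Virasoro module with central charge 1 and conformal dimension $k^2$. Transporting this action by $\rho$ to $\mathcal X=\bigoplus_kM_{2k+1}\otimes\Pi_k$ gives on each $\Pi_k$ the structure of the Virasoro module $L(1,k^2)$ (the transported operators act as $\mathrm{id}\otimes L_m$ on $M_{2k+1}\otimes\Pi_k$).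 *)

theory Defs
  imports Complex_Main "HOL-Library.Poly_Mapping"
begin

section \<open>Complex vector spaces with a given basis\<close>

text \<open>The type \<open>'a \<Rightarrow>\<^sub>0 complex\<close> is the complex vector space with basis \<open>'a\<close>; the basis vector of
  \<open>a\<close> is \<open>Poly_Mapping.single a 1\<close>.\<close>

definition fscale :: "complex \<Rightarrow> ('a \<Rightarrow>\<^sub>0 complex) \<Rightarrow> ('a \<Rightarrow>\<^sub>0 complex)" where
  "fscale c f = Poly_Mapping.map (\<lambda>x. c * x) f"

lemma lookup_fscale [simp]: "Poly_Mapping.lookup (fscale c f) a = c * Poly_Mapping.lookup f a"
  by (cases "Poly_Mapping.lookup f a = 0")
    (simp_all add: fscale_def Poly_Mapping.map.rep_eq when_def)

global_interpretation fv: vector_space "fscale :: complex \<Rightarrow> ('a \<Rightarrow>\<^sub>0 complex) \<Rightarrow> ('a \<Rightarrow>\<^sub>0 complex)"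
  by unfold_locales (auto intro!: poly_mapping_eqI simp: lookup_add algebra_simps)

abbreviation basis_vec :: "'a \<Rightarrow> ('a \<Rightarrow>\<^sub>0 complex)" where
  "basis_vec a \<equiv> Poly_Mapping.single a 1"

definition lin_ext :: "('a \<Rightarrow> ('b \<Rightarrow>\<^sub>0 complex)) \<Rightarrow> ('a \<Rightarrow>\<^sub>0 complex) \<Rightarrow> ('b \<Rightarrow>\<^sub>0 complex)" where
  "lin_ext g f = (\<Sum>a\<in>Poly_Mapping.keys f. fscale (Poly_Mapping.lookup f a) (g a))"

definition tensor :: "('a \<Rightarrow>\<^sub>0 complex) \<Rightarrow> ('b \<Rightarrow>\<^sub>0 complex) \<Rightarrow> ('a \<times> 'b \<Rightarrow>\<^sub>0 complex)"
    (infixr "\<otimes>\<^sub>v" 75) where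
  "x \<otimes>\<^sub>v w = (\<Sum>a\<in>Poly_Mapping.keys x. \<Sum>b\<in>Poly_Mapping.keys w.
     Poly_Mapping.single (a, b) (Poly_Mapping.lookup x a * Poly_Mapping.lookup w b))"

definition std_inner :: "('a \<Rightarrow>\<^sub>0 complex) \<Rightarrow> ('a \<Rightarrow>\<^sub>0 complex) \<Rightarrow> complex" where
  "std_inner f g = (\<Sum>a\<in>Poly_Mapping.keys f.
     Poly_Mapping.lookup f a * cnj (Poly_Mapping.lookup g a))"

section \<open>The Lie algebra and its finite-dimensional modules\<close>

text \<open>The basis \<open>e, h, f\<close> of \<open>sl\<^sub>2\<close>. All actions are linear in the Lie algebra element and are
  therefore given on this basis.\<close>

datatype sl2 = Esl | Hsl | Fsl

text \<open>The irreducible module \<open>M\<^sub>d\<close>, realised on an orthonormal weight basis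
  \<open>u\<^sub>0, \<dots>, u\<^bsub>d-1\<^esub>\<close> (\<open>u\<^sub>0\<close> of lowest weight), with \<open>e\<^sup>* = f\<close> and \<open>h\<^sup>* = h\<close>.\<close>

definition irr_space :: "nat \<Rightarrow> (nat \<Rightarrow>\<^sub>0 complex) set" where
  "irr_space d = {x. Poly_Mapping.keys x \<subseteq> {..<d}}"

fun irr_basis_act :: "nat \<Rightarrow> sl2 \<Rightarrow> nat \<Rightarrow> (nat \<Rightarrow>\<^sub>0 complex)" where
  "irr_basis_act d Esl i =
     Poly_Mapping.single (i + 1) (of_real (sqrt ((real i + 1) * (real d - 1 - real i))))"
| "irr_basis_act d Hsl i = Poly_Mapping.single i (of_real (2 * real i - (real d - 1)))"
| "irr_basis_act d Fsl i =
     Poly_Mapping.single (i - 1) (of_real (sqrt (real i * (real d - real i))))"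

section \<open>The fusion product\<close>

text \<open>The basis of \<open>M\<^sub>2\<^sup>\<otimes>\<^sup>N\<close> formed by the pure tensors in \<open>v\<^sub>0\<close> and \<open>v\<^sub>1 = e v\<^sub>0\<close> is indexed by
  the set \<open>S \<subseteq> {..<N}\<close> of the factors equal to \<open>v\<^sub>1\<close>.\<close>

type_synonym spin = "nat set \<Rightarrow>\<^sub>0 complex"

fun site_act :: "nat \<Rightarrow> sl2 \<Rightarrow> nat set \<Rightarrow> spin" where
  "site_act s Esl S = (if s \<in> S then 0 else basis_vec (insert s S))"
| "site_act s Hsl S = Poly_Mapping.single S (if s \<in> S then 1 else -1)"
| "site_act s Fsl S = (if s \<in> S then basis_vec (S - {s}) else 0)"

text \<open>The action of \<open>x \<otimes> t\<^sup>-\<^sup>i\<close> on \<open>M\<^sub>2(z\<^sub>0) \<otimes> \<dots> \<otimes> M\<^sub>2(z\<^bsub>N-1\<^esub>)\<close>.\<close>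

definition current :: "(nat \<Rightarrow> complex) \<Rightarrow> nat \<Rightarrow> sl2 \<Rightarrow> nat \<Rightarrow> spin \<Rightarrow> spin" where
  "current z N x i = lin_ext (\<lambda>S. \<Sum>s<N. fscale (z s ^ i) (site_act s x S))"

definition cyclic_vec :: spin where
  "cyclic_vec = basis_vec {}"

text \<open>\<open>filt z N m\<close> is \<open>V\<^sub>N\<^sup>(\<^sup>\<le>\<^sup>m\<^sup>)\<close>; the index is an integer so that \<open>filt z N (-1) = {0}\<close>.\<close>

definition filt :: "(nat \<Rightarrow> complex) \<Rightarrow> nat \<Rightarrow> int \<Rightarrow> spin set" where
  "filt z N m = fv.span {foldr (current z N Esl) is cyclic_vec | is. int (sum_list is) \<le> m}"

text \<open>The graded vector space \<open>V\<^sub>N\<^sup>* = \<Oplus>\<^sub>m V\<^sub>N\<^sup>(\<^sup>\<le>\<^sup>m\<^sup>) / V\<^sub>N\<^sup>(\<^sup>\<le>\<^sup>m\<^sup>-\<^sup>1\<^sup>)\<close>: an element is the finitely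
  supported family of its components \<open>\<phi> m\<close>, which are cosets of \<open>filt z N (m - 1)\<close>.\<close>

type_synonym fusion_vec = "nat \<Rightarrow> spin set"

definition fusion :: "(nat \<Rightarrow> complex) \<Rightarrow> nat \<Rightarrow> fusion_vec set" where
  "fusion z N = {\<phi>. (\<forall>m. \<exists>v\<in>filt z N (int m). \<phi> m = (+) v ` filt z N (int m - 1)) \<and>
                    finite {m. \<phi> m \<noteq> filt z N (int m - 1)}}"

definition fusion_add :: "fusion_vec \<Rightarrow> fusion_vec \<Rightarrow> fusion_vec" where
  "fusion_add \<phi> \<psi> = (\<lambda>m. {a + b | a b. a \<in> \<phi> m \<and> b \<in> \<psi> m})"

definition fusion_scale ::
    "(nat \<Rightarrow> complex) \<Rightarrow> nat \<Rightarrow> complex \<Rightarrow> fusion_vec \<Rightarrow> fusion_vec" where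
  "fusion_scale z N c \<phi> = (\<lambda>m. {fscale c a + b | a b. a \<in> \<phi> m \<and> b \<in> filt z N (int m - 1)})"

definition fusion_act ::
    "(nat \<Rightarrow> complex) \<Rightarrow> nat \<Rightarrow> sl2 \<Rightarrow> nat \<Rightarrow> fusion_vec \<Rightarrow> fusion_vec" where
  "fusion_act z N x i \<phi> = (\<lambda>m.
     if i \<le> m then {current z N x i a + b | a b. a \<in> \<phi> (m - i) \<and> b \<in> filt z N (int m - 1)}
     else filt z N (int m - 1))"

text \<open>The class of \<open>v \<in> V\<^sub>N\<^sup>(\<^sup>\<le>\<^sup>m\<^sup>)\<close> in \<open>V\<^sub>N\<^sup>*[-m]\<close>.\<close>

definition fusion_class :: "(nat \<Rightarrow> complex) \<Rightarrow> nat \<Rightarrow> nat \<Rightarrow> spin \<Rightarrow> fusion_vec" where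
  "fusion_class z N m v = (\<lambda>l.
     if l = m then (+) v ` filt z N (int m - 1) else filt z N (int l - 1))"

definition fusion_vac :: "(nat \<Rightarrow> complex) \<Rightarrow> nat \<Rightarrow> fusion_vec" where
  "fusion_vac z N = fusion_class z N 0 cyclic_vec"

definition fusion_piece :: "(nat \<Rightarrow> complex) \<Rightarrow> nat \<Rightarrow> nat \<Rightarrow> fusion_vec set" where
  "fusion_piece z N m = fusion_class z N m ` filt z N (int m)"

definition fusion_linear :: "(nat \<Rightarrow> complex) \<Rightarrow> nat \<Rightarrow> ('b \<Rightarrow> 'b \<Rightarrow> 'b) \<Rightarrow> (complex \<Rightarrow> 'b \<Rightarrow> 'b) \<Rightarrow>
    (fusion_vec \<Rightarrow> 'b) \<Rightarrow> bool" where
  "fusion_linear z N add scale F \<longleftrightarrow>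
     (\<forall>\<phi>\<in>fusion z N. \<forall>\<psi>\<in>fusion z N. F (fusion_add \<phi> \<psi>) = add (F \<phi>) (F \<psi>)) \<and>
     (\<forall>c. \<forall>\<phi>\<in>fusion z N. F (fusion_scale z N c \<phi>) = scale c (F \<phi>))"

text \<open>Injective \<open>sl\<^sub>2 \<otimes> \<complex>[t\<^sup>-\<^sup>1]\<close>-equivariant maps \<open>V\<^sub>N\<^sup>* \<rightarrow> V\<^bsub>N+2\<^esub>\<^sup>*\<close> with
  \<open>v\<^sub>N \<mapsto> e\<^bsub>-(N+1)\<^esub> v\<^bsub>N+2\<^esub>\<close>; here \<open>z N\<close> is the family of evaluation points of \<open>V\<^sub>N\<close>.\<close>

definition fusion_embedding ::
    "(nat \<Rightarrow> nat \<Rightarrow> complex) \<Rightarrow> nat \<Rightarrow> (fusion_vec \<Rightarrow> fusion_vec) \<Rightarrow> bool" where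
  "fusion_embedding z N j \<longleftrightarrow>
     j ` fusion (z N) N \<subseteq> fusion (z (N + 2)) (N + 2) \<and>
     inj_on j (fusion (z N) N) \<and>
     fusion_linear (z N) N fusion_add (fusion_scale (z (N + 2)) (N + 2)) j \<and>
     (\<forall>x i. \<forall>\<phi>\<in>fusion (z N) N.
        j (fusion_act (z N) N x i \<phi>) = fusion_act (z (N + 2)) (N + 2) x i (j \<phi>)) \<and>
     j (fusion_vac (z N) N)
       = fusion_act (z (N + 2)) (N + 2) Esl (N + 1) (fusion_vac (z (N + 2)) (N + 2))"

text \<open>The space \<open>'v\<close> with the canonical maps \<open>\<iota> N\<close> is the direct limit of the system
  \<open>(V\<^sub>N\<^sup>*, j N)\<close>, \<open>N\<close> even. Since the transition maps are injective, so are the \<open>\<iota> N\<close>.\<close>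

definition is_fusion_limit :: "(nat \<Rightarrow> nat \<Rightarrow> complex) \<Rightarrow> (nat \<Rightarrow> fusion_vec \<Rightarrow> fusion_vec) \<Rightarrow>
    (complex \<Rightarrow> 'v::ab_group_add \<Rightarrow> 'v) \<Rightarrow> (nat \<Rightarrow> fusion_vec \<Rightarrow> 'v) \<Rightarrow> bool" where
  "is_fusion_limit z j sc \<iota> \<longleftrightarrow>
     vector_space sc \<and>
     (\<forall>N. even N \<longrightarrow>
        fusion_linear (z N) N (+) sc (\<iota> N) \<and>
        inj_on (\<iota> N) (fusion (z N) N) \<and>
        (\<forall>\<phi>\<in>fusion (z N) N. \<iota> (N + 2) (j N \<phi>) = \<iota> N \<phi>)) \<and>
     (\<Union>N\<in>{N. even N}. \<iota> N ` fusion (z N) N) = UNIV"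

section \<open>The basic representation of affine \<open>sl\<^sub>2\<close>\<close>

text \<open>\<open>act x m\<close> is the action of \<open>x \<otimes> t\<^sup>m\<close>, and the central element acts by \<open>K\<close>. The bracket is
  \<open>[x \<otimes> t\<^sup>m, y \<otimes> t\<^sup>l] = [x, y] \<otimes> t\<^bsup>m+l\<^esup> - m \<delta>\<^bsub>m+l,0\<^esub> tr(x y) c\<close> with
  \<open>tr(h h) = 2\<close>, \<open>tr(e f) = 1\<close> and \<open>tr(e e) = tr(f f) = tr(h e) = tr(h f) = 0\<close>.\<close>

definition affine_sl2_rep :: "(complex \<Rightarrow> 'v::ab_group_add \<Rightarrow> 'v) \<Rightarrow> complex \<Rightarrow>
    (sl2 \<Rightarrow> int \<Rightarrow> 'v \<Rightarrow> 'v) \<Rightarrow> bool" where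
  "affine_sl2_rep sc K act \<longleftrightarrow>
     (\<forall>x m. Vector_Spaces.linear sc sc (act x m)) \<and>
     (\<forall>m l v.
        act Esl m (act Esl l v) - act Esl l (act Esl m v) = 0 \<and>
        act Fsl m (act Fsl l v) - act Fsl l (act Fsl m v) = 0 \<and>
        act Hsl m (act Hsl l v) - act Hsl l (act Hsl m v)
          = - sc (if m + l = 0 then 2 * of_int m * K else 0) v \<and>
        act Hsl m (act Esl l v) - act Esl l (act Hsl m v) = sc 2 (act Esl (m + l) v) \<and>
        act Hsl m (act Fsl l v) - act Fsl l (act Hsl m v) = sc (-2) (act Fsl (m + l) v) \<and>
        act Esl m (act Fsl l v) - act Fsl l (act Esl m v)
          = act Hsl (m + l) v - sc (if m + l = 0 then of_int m * K else 0) v)"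

text \<open>\<open>L\<^bsub>0,1\<^esub>\<close>: the irreducible representation of level 1 with a vacuum vector annihilated by
  \<open>sl\<^sub>2 \<otimes> \<complex>[t\<^sup>-\<^sup>1]\<close>.\<close>

definition basic_rep :: "(complex \<Rightarrow> 'v::ab_group_add \<Rightarrow> 'v) \<Rightarrow> (sl2 \<Rightarrow> int \<Rightarrow> 'v \<Rightarrow> 'v) \<Rightarrow>
    'v \<Rightarrow> bool" where
  "basic_rep sc act vac \<longleftrightarrow>
     affine_sl2_rep sc 1 act \<and>
     vac \<noteq> 0 \<and> (\<forall>x m. m \<le> 0 \<longrightarrow> act x m vac = 0) \<and>
     (\<forall>U. module.subspace sc U \<and> (\<forall>x m. act x m ` U \<subseteq> U) \<longrightarrow> U = {0} \<or> U = UNIV)"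

definition pos_def_hermitian ::
    "(complex \<Rightarrow> 'v::ab_group_add \<Rightarrow> 'v) \<Rightarrow> ('v \<Rightarrow> 'v \<Rightarrow> complex) \<Rightarrow> bool" where
  "pos_def_hermitian sc ip \<longleftrightarrow>
     (\<forall>u v w. ip (u + v) w = ip u w + ip v w) \<and>
     (\<forall>c u w. ip (sc c u) w = c * ip u w) \<and>
     (\<forall>u w. ip w u = cnj (ip u w)) \<and>
     (\<forall>u. u \<noteq> 0 \<longrightarrow> Re (ip u u) > 0)"

definition contravariant_form ::
    "(sl2 \<Rightarrow> int \<Rightarrow> 'v \<Rightarrow> 'v) \<Rightarrow> ('v \<Rightarrow> 'v \<Rightarrow> complex) \<Rightarrow> bool" where
  "contravariant_form act ip \<longleftrightarrow>
     (\<forall>m u w. ip (act Esl m u) w = ip u (act Fsl (- m) w) \<and>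
              ip (act Hsl m u) w = ip u (act Hsl (- m) w))"

section \<open>The Virasoro operators\<close>

definition heis :: "(complex \<Rightarrow> 'v \<Rightarrow> 'v) \<Rightarrow> (sl2 \<Rightarrow> int \<Rightarrow> 'v \<Rightarrow> 'v) \<Rightarrow> int \<Rightarrow> 'v \<Rightarrow> 'v" where
  "heis sc act m v = sc (1 / of_real (sqrt 2)) (act Hsl (- m) v)"

text \<open>The sums have only finitely many nonzero terms on every vector of the basic representation;
  \<open>Sum_any\<close> is the sum of the nonzero terms.\<close>

definition vir :: "(complex \<Rightarrow> 'v::ab_group_add \<Rightarrow> 'v) \<Rightarrow> (sl2 \<Rightarrow> int \<Rightarrow> 'v \<Rightarrow> 'v) \<Rightarrow>
    int \<Rightarrow> 'v \<Rightarrow> 'v" where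
  "vir sc act m v = (let a = heis sc act in
     if m = 0
     then sc (1/2) (a 0 (a 0 v)) + Sum_any (\<lambda>j::int. if 1 \<le> j then a (- j) (a j v) else 0)
     else sc (1/2) (Sum_any (\<lambda>j::int. a (- j) (a (j + m) v))))"

section \<open>Two-row standard Young tableaux\<close>

text \<open>A (finite or infinite) tableau is the function sending a cell, given by its row and its column
  (both counted from 0), to the entry in the cell; the value 0 means that there is no cell. The
  entries themselves are positive.\<close>

type_synonym tableau = "nat \<Rightarrow> nat \<Rightarrow> nat"

definition cells :: "tableau \<Rightarrow> (nat \<times> nat) set" where
  "cells \<tau> = {(r, c). \<tau> r c \<noteq> 0}"

definition in_row :: "tableau \<Rightarrow> nat \<Rightarrow> nat \<Rightarrow> bool" where
  "in_row \<tau> r i \<longleftrightarrow> (\<exists>c. \<tau> r c = i)"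

definition row_length :: "tableau \<Rightarrow> nat \<Rightarrow> nat" where
  "row_length \<tau> r = card {c. \<tau> r c \<noteq> 0}"

definition increasing_tableau :: "tableau \<Rightarrow> bool" where
  "increasing_tableau \<tau> \<longleftrightarrow>
     (\<forall>r c. \<tau> r (c + 1) \<noteq> 0 \<longrightarrow> \<tau> r c < \<tau> r (c + 1)) \<and>
     (\<forall>r c. \<tau> (r + 1) c \<noteq> 0 \<longrightarrow> \<tau> r c < \<tau> (r + 1) c)"

definition has_shape :: "tableau \<Rightarrow> nat \<Rightarrow> nat \<Rightarrow> bool" where
  "has_shape \<tau> a b \<longleftrightarrow> b \<le> a \<and> cells \<tau> = {0} \<times> {..<a} \<union> {1} \<times> {..<b}"

definition SYT :: "nat \<Rightarrow> nat \<Rightarrow> tableau set" where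
  "SYT a b = {\<tau>. has_shape \<tau> a b \<and> increasing_tableau \<tau> \<and>
                 bij_betw (\<lambda>(r, c). \<tau> r c) (cells \<tau>) {1..a + b}}"

definition infinite_SYT :: "tableau set" where
  "infinite_SYT = {\<tau>. cells \<tau> = {0, 1} \<times> UNIV \<and> increasing_tableau \<tau> \<and>
                      bij_betw (\<lambda>(r, c). \<tau> r c) (cells \<tau>) {1..}}"

definition maj :: "tableau \<Rightarrow> nat" where
  "maj \<tau> = \<Sum> {i. 1 \<le> i \<and> (\<exists>r r'. r < r' \<and> in_row \<tau> r i \<and> in_row \<tau> r' (i + 1))}"

definition subtableau :: "tableau \<Rightarrow> nat \<Rightarrow> tableau" where
  "subtableau \<tau> l = (\<lambda>r c. if \<tau> r c \<le> l then \<tau> r c else 0)"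

text \<open>The tableau \<open>\<tau>'\<close> obtained from a tableau \<open>\<tau>\<close> with \<open>N\<close> cells by adding \<open>N + 1\<close> to the first
  row and \<open>N + 2\<close> to the second, and the infinite tableau obtained by iterating this.\<close>

definition add_two :: "nat \<Rightarrow> tableau \<Rightarrow> tableau" where
  "add_two N \<tau> = (\<lambda>r c.
     if r = 0 \<and> c = row_length \<tau> 0 then N + 1
     else if r = 1 \<and> c = row_length \<tau> 1 then N + 2
     else \<tau> r c)"

definition add_inf :: "nat \<Rightarrow> tableau \<Rightarrow> tableau" where
  "add_inf N \<tau> = (\<lambda>r c.
     if r < 2 \<and> row_length \<tau> r \<le> c then N + 2 * (c - row_length \<tau> r) + r + 1 else \<tau> r c)"

text \<open>\<open>\<tau>\<^sub>k\<close>, with first row \<open>1, \<dots>, 2k, 2k+1, 2k+3, \<dots>\<close> and second row \<open>2k+2, 2k+4, \<dots>\<close>.\<close>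

definition tau :: "nat \<Rightarrow> tableau" where
  "tau k = (\<lambda>r c.
     if r = 0 then (if c < 2 * k then c + 1 else 2 * k + 1 + 2 * (c - 2 * k))
     else if r = 1 then 2 * k + 2 + 2 * c
     else 0)"

definition tail_tableaux :: "nat \<Rightarrow> tableau set" where
  "tail_tableaux k = {\<tau> \<in> infinite_SYT.
     finite {i. \<exists>r. in_row \<tau> r i \<noteq> in_row (tau k) r i} \<and>
     (\<exists>n\<^sub>0\<ge>k. \<forall>n\<ge>n\<^sub>0. has_shape (subtableau \<tau> (2 * n)) (n + k) (n - k))}"

definition stable_maj :: "tableau \<Rightarrow> real" where
  "stable_maj \<tau> = lim (\<lambda>n. (real n)\<^sup>2 - real (maj (subtableau \<tau> (2 * n))))"

section \<open>The spaces \<open>X\<^sub>N\<close> and their limit\<close>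

text \<open>The limit \<open>\<Oplus>\<^sub>k M\<^bsub>2k+1\<^esub> \<otimes> \<Pi>\<^sub>k\<close> is the space spanned by the \<open>u\<^sub>i \<otimes> \<tau>\<close> with \<open>\<tau>\<close> in
  \<open>tail_tableaux k\<close> and \<open>i < 2k + 1\<close>; \<open>X_to_limit N\<close> is the canonical map from \<open>X\<^sub>N\<close> into it.
  \<open>X\<^sub>N\<close> has the orthonormal basis \<open>u\<^sub>i \<otimes> \<tau>\<close> with \<open>\<tau>\<close> of shape \<open>(n+k, n-k)\<close> and \<open>u\<^sub>i\<close> in the
  orthonormal basis of \<open>M\<^bsub>2k+1\<^esub>\<close>. The number \<open>k\<close> is determined by \<open>\<tau>\<close>.\<close>

type_synonym tab_space = "nat \<times> tableau \<Rightarrow>\<^sub>0 complex"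

definition X_space :: "nat \<Rightarrow> tab_space set" where
  "X_space N = {y. \<forall>(i, \<tau>)\<in>Poly_Mapping.keys y.
     \<exists>k\<le>N div 2. \<tau> \<in> SYT (N div 2 + k) (N div 2 - k) \<and> i < 2 * k + 1}"

definition X_graded :: "nat \<Rightarrow> nat \<Rightarrow> tab_space set" where
  "X_graded N m = {y \<in> X_space N. \<forall>(i, \<tau>)\<in>Poly_Mapping.keys y. maj \<tau> = m}"

definition X_act :: "sl2 \<Rightarrow> tab_space \<Rightarrow> tab_space" where
  "X_act x = lin_ext (\<lambda>(i, \<tau>).
     irr_basis_act (row_length \<tau> 0 - row_length \<tau> 1 + 1) x i \<otimes>\<^sub>v basis_vec \<tau>)"

definition X_step :: "nat \<Rightarrow> tab_space \<Rightarrow> tab_space" where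
  "X_step N = lin_ext (\<lambda>(i, \<tau>). basis_vec (i, add_two N \<tau>))"

definition X_to_limit :: "nat \<Rightarrow> tab_space \<Rightarrow> tab_space" where
  "X_to_limit N = lin_ext (\<lambda>(i, \<tau>). basis_vec (i, add_inf N \<tau>))"

definition Pi_space :: "nat \<Rightarrow> (tableau \<Rightarrow>\<^sub>0 complex) set" where
  "Pi_space k = {w. Poly_Mapping.keys w \<subseteq> tail_tableaux k}"

section \<open>The isomorphism and the transported operators\<close>

text \<open>\<open>V\<^sub>N\<^sup>*\<close> carries the restriction along \<open>\<iota>\<close> of the form \<open>ip\<close> of the limit.\<close>

definition graded_unitary_iso :: "(nat \<Rightarrow> complex) \<Rightarrow> nat \<Rightarrow> (fusion_vec \<Rightarrow> 'v) \<Rightarrow>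
    ('v \<Rightarrow> 'v \<Rightarrow> complex) \<Rightarrow> (fusion_vec \<Rightarrow> tab_space) \<Rightarrow> bool" where
  "graded_unitary_iso z N \<iota> ip R \<longleftrightarrow>
     bij_betw R (fusion z N) (X_space N) \<and>
     fusion_linear z N (+) fscale R \<and>
     (\<forall>x. \<forall>\<phi>\<in>fusion z N. R (fusion_act z N x 0 \<phi>) = X_act x (R \<phi>)) \<and>
     (\<forall>\<phi>\<in>fusion z N. \<forall>\<psi>\<in>fusion z N. std_inner (R \<phi>) (R \<psi>) = ip (\<iota> \<phi>) (\<iota> \<psi>)) \<and>
     (\<forall>m. R ` fusion_piece z N m \<subseteq> X_graded N m)"

definition transport :: "('v \<Rightarrow> tab_space) \<Rightarrow> ('v \<Rightarrow> 'v) \<Rightarrow> tab_space \<Rightarrow> tab_space" where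
  "transport \<rho> A y = \<rho> (A (inv_into UNIV \<rho> y))"

definition acts_as_id_tensor ::
    "nat \<Rightarrow> (tab_space \<Rightarrow> tab_space) \<Rightarrow> ((tableau \<Rightarrow>\<^sub>0 complex) \<Rightarrow> (tableau \<Rightarrow>\<^sub>0 complex)) \<Rightarrow> bool" where
  "acts_as_id_tensor k A B \<longleftrightarrow>
     B ` Pi_space k \<subseteq> Pi_space k \<and>
     (\<forall>x\<in>irr_space (2 * k + 1). \<forall>w\<in>Pi_space k. A (x \<otimes>\<^sub>v w) = x \<otimes>\<^sub>v B w)"

text \<open>The operator \<open>B\<close> on \<open>\<Pi>\<^sub>k\<close> for which the operator \<open>A\<close> acts as \<open>id \<otimes> B\<close> on \<open>M\<^bsub>2k+1\<^esub> \<otimes> \<Pi>\<^sub>k\<close>.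
  It is meaningful only if a \<open>B\<close> with \<open>acts_as_id_tensor k A B\<close> exists.\<close>

definition Pi_op ::
    "nat \<Rightarrow> (tab_space \<Rightarrow> tab_space) \<Rightarrow> (tableau \<Rightarrow>\<^sub>0 complex) \<Rightarrow> (tableau \<Rightarrow>\<^sub>0 complex)" where
  "Pi_op k A w = (THE w'. w' \<in> Pi_space k \<and>
     (\<forall>x\<in>irr_space (2 * k + 1). A (x \<otimes>\<^sub>v w) = x \<otimes>\<^sub>v w'))"

end

theory Submission
  imports Defs "HOL-Computational_Algebra.Polynomial"
begin

text \<open>
  Write \<open>e m\<close>, \<open>f m\<close>, \<open>h m\<close> for the action of \<open>e \<otimes> t\<^sup>m\<close>, \<open>f \<otimes> t\<^sup>m\<close>, \<open>h \<otimes> t\<^sup>m\<close> on the limit, and let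
  \<open>v\<^sub>N\<close> (\<open>N = 2n\<close>) be the image of the generator of the \<open>N\<close>-th fusion product. The whole theorem
  comes down to the commutation relation \<open>[L\<^sub>0, e m] = m (e m)\<close> for the operator \<open>L\<^sub>0\<close> that is built
  from the Heisenberg algebra of the \<open>h m\<close> alone (lemma \<open>L0_e\<close>). Indeed \<open>v\<^sub>N\<close> is killed by \<open>h (-i)\<close>
  for \<open>i > 0\<close> and has weight \<open>-N\<close>, so that \<open>L\<^sub>0 v\<^sub>N = (N\<^sup>2/4) v\<^sub>N = n\<^sup>2 v\<^sub>N\<close>; and the component of degree
  \<open>-m\<close> of the fusion product is spanned by classes of vectors \<open>e (-i\<^sub>1) \<dots> e (-i\<^sub>l) v\<^sub>N\<close> with
  \<open>i\<^sub>1 + \<dots> + i\<^sub>l = m\<close>, on which \<open>L\<^sub>0\<close> then acts as \<open>n\<^sup>2 - m\<close> (lemma \<open>L0_homogeneous\<close>). The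
  isomorphism with the tableau space sends this component to tableaux of major index \<open>m\<close>, so on
  every finite level \<open>L\<^sub>0\<close> becomes multiplication by \<open>n\<^sup>2 - maj\<close>. Adding \<open>2n+1\<close> to the first and
  \<open>2n+2\<close> to the second row creates exactly one new descent, at \<open>2n+1 = (n+1)\<^sup>2 - n\<^sup>2\<close>. Hence
  \<open>n\<^sup>2 - maj\<close> is eventually constant along the truncations of a tableau in \<open>\<T>\<^sub>k\<close>, with value the stable
  major index.

  The relation \<open>[L\<^sub>0, e m] = m (e m)\<close> is the differential equation of the level one vertex operator. It
  follows from the vanishing of the square of the current \<open>e(x)\<close>, that is, of all the sums
  \<open>\<Sum>\<^sub>i e i (e (m - i))\<close>: the commutator of such a sum with \<open>f 0\<close> is, up to sign, the sum of
  the \<open>h i (e (m - i)) + e i (h (m - i))\<close>, and putting the factors into normal order turns it into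
  \<open>2 [L\<^sub>0, e m] - 2m (e m)\<close>.

  The square of \<open>e(x)\<close> vanishes for the following reason. On a vacuum vector, the inner product of
  \<open>\<Sum>\<^sub>i e i (e (m - i))\<close> with every summand can be computed from the commutation relations and is 0 at
  level one, so the vector has norm 0 and the form is positive definite (lemma \<open>e_square_vac\<close>). The
  vector \<open>v\<^sub>N\<close> becomes a vacuum vector for the action twisted by the spectral flow automorphism of the
  affine algebra, which only shifts the modes of \<open>e(x)\<close>; thus the square of \<open>e(x)\<close> also kills every
  \<open>v\<^sub>N\<close> (lemma \<open>e_square_extremal\<close>). Since it commutes with all \<open>e m\<close>, and the \<open>v\<^sub>N\<close> generate the
  limit under the \<open>e (-i)\<close>, it is zero (lemma \<open>all_e_square_null\<close>).
\<close>

section \<open>Spaces with a basis\<close>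

lemma lin_ext_superset:
  assumes "finite A" "Poly_Mapping.keys w \<subseteq> A"
  shows "lin_ext g w = (\<Sum>a\<in>A. fscale (Poly_Mapping.lookup w a) (g a))"
  unfolding lin_ext_def
  by (rule sum.mono_neutral_left) (use assms in \<open>auto simp: in_keys_iff\<close>)

lemma lin_ext_add: "lin_ext g (u + w) = lin_ext g u + lin_ext g w"
proof -
  let ?A = "Poly_Mapping.keys u \<union> Poly_Mapping.keys w"
  have "lin_ext g x = (\<Sum>a\<in>?A. fscale (Poly_Mapping.lookup x a) (g a))" if "x \<in> {u, w, u + w}" for x
    by (rule lin_ext_superset) (use that keys_add[of u w] in auto)
  then show ?thesis by (simp add: lookup_add fv.scale_left_distrib sum.distrib)
qed

lemma lin_ext_scale: "lin_ext g (fscale c w) = fscale c (lin_ext g w)"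
proof -
  have "lin_ext g (fscale c w) = (\<Sum>a\<in>Poly_Mapping.keys w. fscale (Poly_Mapping.lookup (fscale c w) a) (g a))"
    by (rule lin_ext_superset) (auto simp: in_keys_iff)
  then show ?thesis by (simp add: lin_ext_def fv.scale_sum_right)
qed

lemma lin_ext_zero [simp]: "lin_ext g 0 = 0"
  by (simp add: lin_ext_def)

lemma lin_ext_single [simp]: "lin_ext g (Poly_Mapping.single a c) = fscale c (g a)"
  by (subst lin_ext_superset[of "{a}"]) auto

lemma lin_ext_sum: "lin_ext g (sum u A) = (\<Sum>a\<in>A. lin_ext g (u a))"
  by (induction A rule: infinite_finite_induct) (auto simp: lin_ext_add)

lemma fscale_single [simp]: "fscale c (Poly_Mapping.single a d) = Poly_Mapping.single a (c * d)"
  by (rule poly_mapping_eqI) (simp add: lookup_single when_def)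

lemma lin_ext_basis_vec: "lin_ext basis_vec w = w"
  by (rule poly_mapping_eqI)
    (simp add: lin_ext_def lookup_sum lookup_single when_def in_keys_iff sum.delta)

lemma linear_eq_from_basis:
  assumes "\<And>a. F (basis_vec a) = G (basis_vec a)"
    and "\<And>u w. F (u + w) = F u + F w" "\<And>c u. F (fscale c u) = fscale c (F u)"
    and "\<And>u w. G (u + w) = G u + G w" "\<And>c u. G (fscale c u) = fscale c (G u)"
  shows "F w = G w"
proof -
  have sums: "F (\<Sum>a\<in>A. fscale (c a) (basis_vec a)) = G (\<Sum>a\<in>A. fscale (c a) (basis_vec a))" for A c
  proof (induction A rule: infinite_finite_induct)
    case (insert a A)
    then show ?case using assms by (simp del: fscale_single)
  qed (use assms(3)[of 0 0] assms(5)[of 0 0] in simp_all)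
  have "w = (\<Sum>a\<in>Poly_Mapping.keys w. fscale (Poly_Mapping.lookup w a) (basis_vec a))"
    using lin_ext_basis_vec[of w] by (simp add: lin_ext_def)
  then show ?thesis using sums by metis
qed

definition diag_op :: "('a \<Rightarrow> complex) \<Rightarrow> ('a \<Rightarrow>\<^sub>0 complex) \<Rightarrow> ('a \<Rightarrow>\<^sub>0 complex)" where
  "diag_op c = lin_ext (\<lambda>a. fscale (c a) (basis_vec a))"

lemma lookup_diag_op [simp]: "Poly_Mapping.lookup (diag_op c w) a = c a * Poly_Mapping.lookup w a"
proof -
  have "Poly_Mapping.lookup (diag_op c w) a
      = (\<Sum>b\<in>Poly_Mapping.keys w. Poly_Mapping.lookup w b * Poly_Mapping.lookup (fscale (c b) (basis_vec b)) a)"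
    by (simp add: diag_op_def lin_ext_def lookup_sum mult.assoc del: fscale_single)
  also have "\<dots> = (\<Sum>b\<in>Poly_Mapping.keys w. if b = a then c a * Poly_Mapping.lookup w a else 0)"
    by (intro sum.cong) (auto simp: lookup_single when_def)
  also have "\<dots> = c a * Poly_Mapping.lookup w a"
    by (simp add: sum.delta' sum.delta in_keys_iff)
  finally show ?thesis .
qed

lemma diag_op_add: "diag_op c (u + w) = diag_op c u + diag_op c w"
  and diag_op_scale: "diag_op c (fscale d u) = fscale d (diag_op c u)"
  by (simp_all add: diag_op_def lin_ext_add lin_ext_scale)

lemma keys_diag_op: "Poly_Mapping.keys (diag_op c w) \<subseteq> Poly_Mapping.keys w"
  by (auto simp: in_keys_iff)

lemma basis_expansion: "w = (\<Sum>a\<in>Poly_Mapping.keys w. fscale (Poly_Mapping.lookup w a) (basis_vec a))"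
  using lin_ext_basis_vec[of w] by (simp add: lin_ext_def)

text \<open>An injective relabelling of the basis keeps coordinates.\<close>

lemma lookup_relabelled:
  assumes "inj_on g D" "Poly_Mapping.keys y \<subseteq> D" "a \<in> D"
  shows "Poly_Mapping.lookup (lin_ext (\<lambda>a. basis_vec (g a)) y) (g a) = Poly_Mapping.lookup y a"
proof -
  have "Poly_Mapping.lookup (lin_ext (\<lambda>a. basis_vec (g a)) y) (g a)
      = (\<Sum>b\<in>Poly_Mapping.keys y. Poly_Mapping.lookup y b * Poly_Mapping.lookup (basis_vec (g b)) (g a))"
    by (simp add: lin_ext_def lookup_sum del: fscale_single)
  also have "\<dots> = (\<Sum>b\<in>Poly_Mapping.keys y. if b = a then Poly_Mapping.lookup y a else 0)"
  proof (intro sum.cong refl)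
    fix b assume "b \<in> Poly_Mapping.keys y"
    then have "g b = g a \<longleftrightarrow> b = a" using assms by (auto dest: inj_onD)
    then show "Poly_Mapping.lookup y b * Poly_Mapping.lookup (basis_vec (g b)) (g a)
        = (if b = a then Poly_Mapping.lookup y a else 0)" by (auto simp: lookup_single when_def)
  qed
  also have "\<dots> = Poly_Mapping.lookup y a"
    by (simp add: sum.delta' sum.delta in_keys_iff)
  finally show ?thesis .
qed

lemma lookup_tensor [simp]:
  "Poly_Mapping.lookup (x \<otimes>\<^sub>v w) (a, b) = Poly_Mapping.lookup x a * Poly_Mapping.lookup w b"
proof -
  have "Poly_Mapping.lookup (x \<otimes>\<^sub>v w) (a, b)
    = (\<Sum>a'\<in>Poly_Mapping.keys x. \<Sum>b'\<in>Poly_Mapping.keys w.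
        if b' = b then if a' = a then Poly_Mapping.lookup x a * Poly_Mapping.lookup w b else 0 else 0)"
    unfolding tensor_def lookup_sum
    by (intro sum.cong refl) (auto simp: lookup_single when_def)
  also have "\<dots> = Poly_Mapping.lookup x a * Poly_Mapping.lookup w b"
    by (cases "Poly_Mapping.lookup w b = 0") (simp_all add: sum.delta in_keys_iff)
  finally show ?thesis .
qed

lemma tensor_diag_op: "x \<otimes>\<^sub>v diag_op c w = diag_op (\<lambda>(a, b). c b) (x \<otimes>\<^sub>v w)"
  by (rule poly_mapping_eqI) (auto simp: split_paired_all)

lemma keys_tensor: "Poly_Mapping.keys (x \<otimes>\<^sub>v w) \<subseteq> Poly_Mapping.keys x \<times> Poly_Mapping.keys w"
  by (auto simp: in_keys_iff)

lemma basis_vec_inject [simp]: "(basis_vec a :: 'a \<Rightarrow>\<^sub>0 complex) = basis_vec b \<longleftrightarrow> a = b"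
  by (metis lookup_single_eq lookup_single_not_eq zero_neq_one)

lemma independent_basis_vec: "fv.independent (basis_vec ` T)"
  unfolding fv.dependent_explicit
proof (clarify)
  fix U :: "('a \<Rightarrow>\<^sub>0 complex) set" and c v
  assume U: "finite U" "U \<subseteq> basis_vec ` T" and z: "(\<Sum>v\<in>U. fscale (c v) v) = 0" and v: "v \<in> U" "c v \<noteq> 0"
  then obtain t where t: "v = basis_vec t" by blast
  have "0 = (\<Sum>u\<in>U. c u * Poly_Mapping.lookup u t)"
    using arg_cong[OF z, of "\<lambda>w. Poly_Mapping.lookup w t"] by (simp add: lookup_sum)
  also have "\<dots> = (\<Sum>u\<in>U. if u = v then c v else 0)"
  proof (intro sum.cong refl)
    fix u assume "u \<in> U"
    then obtain s where s: "u = basis_vec s" using U by blast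
    show "c u * Poly_Mapping.lookup u t = (if u = v then c v else 0)"
      by (cases "s = t") (auto simp: s t lookup_single when_def)
  qed
  also have "\<dots> = c v" using U v by simp
  finally show False using v by simp
qed

lemma subspace_Pi_space: "fv.subspace (Pi_space k)"
proof -
  have eq: "Pi_space k = {w. \<forall>a. a \<notin> tail_tableaux k \<longrightarrow> Poly_Mapping.lookup w a = 0}"
    unfolding Pi_space_def by (auto simp: in_keys_iff)
  show ?thesis unfolding eq by (rule fv.subspaceI) (simp_all add: lookup_add)
qed

lemma span_basis_vec_tail: "fv.span (basis_vec ` tail_tableaux k) = Pi_space k"
proof
  show "fv.span (basis_vec ` tail_tableaux k) \<subseteq> Pi_space k"
    by (rule fv.span_minimal[OF _ subspace_Pi_space]) (auto simp: Pi_space_def)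
  show "Pi_space k \<subseteq> fv.span (basis_vec ` tail_tableaux k)"
  proof
    fix w assume "w \<in> Pi_space k"
    then have "(\<Sum>a\<in>Poly_Mapping.keys w. fscale (Poly_Mapping.lookup w a) (basis_vec a))
        \<in> fv.span (basis_vec ` tail_tableaux k)"
      by (intro fv.span_sum fv.span_scale fv.span_base) (auto simp: Pi_space_def)
    then show "w \<in> fv.span (basis_vec ` tail_tableaux k)" using basis_expansion[of w] by simp
  qed
qed

section \<open>Unitary level one representations\<close>

text \<open>The bookkeeping at the end of the proof of \<open>L0_e\<close>: the correction terms of normal ordering on the two
sides of the index 0 almost cancel.\<close>

lemma cancel_common_term:
  fixes a :: "'a::ab_group_add"
  assumes "s = (p + b) + g + (x - c)" "s = 0" "c = a + b"
  shows "a = p + g + x"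
proof -
  have "(p + g + x) - a = s" unfolding assms(1,3) by (simp add: algebra_simps)
  then show ?thesis using assms(2) by simp
qed

locale unitary_level_one = vector_space sc
  for sc :: "complex \<Rightarrow> 'v::ab_group_add \<Rightarrow> 'v" +
  fixes act :: "sl2 \<Rightarrow> int \<Rightarrow> 'v \<Rightarrow> 'v" and ip :: "'v \<Rightarrow> 'v \<Rightarrow> complex"
  assumes rep: "affine_sl2_rep sc 1 act"
    and herm: "pos_def_hermitian sc ip"
    and contra: "contravariant_form act ip"
begin

abbreviation "e \<equiv> act Esl"
abbreviation "f \<equiv> act Fsl"
abbreviation "h \<equiv> act Hsl"

lemma act_linear: "Vector_Spaces.linear sc sc (act x m)"
  using rep by (simp add: affine_sl2_rep_def)

lemma act_module_hom: "module_hom sc sc (act x m)"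
  by (rule Vector_Spaces.linear.axioms(3)[OF act_linear])

lemmas act_add = module_hom.add[OF act_module_hom]
lemmas act_diff = module_hom.diff[OF act_module_hom]
lemmas act_scale = module_hom.scale[OF act_module_hom]
lemmas act_zero [simp] = module_hom.zero[OF act_module_hom]
lemmas act_sum = module_hom.sum[OF act_module_hom]
lemmas act_uminus = module_hom.neg[OF act_module_hom]

text \<open>The level one relations, solved so that modes can be moved past each other.\<close>

lemma e_e: "e m (e l v) = e l (e m v)"
  and h_h: "h m (h l v) = h l (h m v) - sc (if m + l = 0 then 2 * of_int m else 0) v"
  and h_e: "h m (e l v) = e l (h m v) + sc 2 (e (m + l) v)"
  and h_f: "h m (f l v) = f l (h m v) - sc 2 (f (m + l) v)"
  and f_e: "f l (e m v) = e m (f l v) - h (m + l) v + sc (if m + l = 0 then of_int m else 0) v"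
proof -
  note r = rep[unfolded affine_sl2_rep_def, THEN conjunct2, rule_format, of m l v]
  show "e m (e l v) = e l (e m v)" using r by simp
  show "h m (h l v) = h l (h m v) - sc (if m + l = 0 then 2 * of_int m else 0) v"
    using r by (simp add: algebra_simps split: if_splits)
  show "h m (e l v) = e l (h m v) + sc 2 (e (m + l) v)" using r by (simp add: algebra_simps)
  show "h m (f l v) = f l (h m v) - sc 2 (f (m + l) v)"
    using r by (simp add: algebra_simps scale_minus_left)
  show "f l (e m v) = e m (f l v) - h (m + l) v + sc (if m + l = 0 then of_int m else 0) v"
    using r by (simp add: algebra_simps split: if_splits)
qed

lemma ip_add: "ip (u + v) w = ip u w + ip v w"
  and ip_scale: "ip (sc c u) w = c * ip u w"
  and ip_cnj: "ip w u = cnj (ip u w)"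
  and ip_pos: "u \<noteq> 0 \<Longrightarrow> Re (ip u u) > 0"
proof -
  note p = herm[unfolded pos_def_hermitian_def]
  show "ip (u + v) w = ip u w + ip v w" using p by blast
  show "ip (sc c u) w = c * ip u w" using p by blast
  show "ip w u = cnj (ip u w)" using p by blast
  show "u \<noteq> 0 \<Longrightarrow> Re (ip u u) > 0" using p by blast
qed

lemma ip_zero [simp]: "ip 0 w = 0"
  using ip_add[of 0 0 w] by simp

lemma ip_zero_right [simp]: "ip w 0 = 0"
  using ip_cnj[of w 0] by simp

lemma ip_diff: "ip (u - v) w = ip u w - ip v w"
  using ip_add[of "u - v" v w] by simp

lemma ip_uminus: "ip (- v) w = - ip v w"
  using ip_diff[of 0 v w] by simp

lemma ip_sum: "ip (sum g A) w = (\<Sum>a\<in>A. ip (g a) w)"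
  by (induction A rule: infinite_finite_induct) (auto simp: ip_add)

lemma ip_add_right: "ip w (u + v) = ip w u + ip w v"
  by (metis ip_cnj ip_add complex_cnj_add)

lemma ip_diff_right: "ip w (u - v) = ip w u - ip w v"
  by (metis ip_cnj ip_diff complex_cnj_diff)

lemma ip_uminus_right: "ip w (- u) = - ip w u"
  by (metis ip_cnj ip_uminus complex_cnj_minus)

lemma ip_scale_right: "ip w (sc c u) = cnj c * ip w u"
  by (metis ip_cnj ip_scale complex_cnj_mult)

lemma ip_sum_right: "ip w (sum g A) = (\<Sum>a\<in>A. ip w (g a))"
  by (induction A rule: infinite_finite_induct) (auto simp: ip_add_right)

lemma ip_self_zero: "ip u u = 0 \<Longrightarrow> u = 0"
  using ip_pos[of u] by force

lemma e_adj: "ip (e m u) w = ip u (f (- m) w)"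
  and h_adj: "ip (h m u) w = ip u (h (- m) w)"
  using contra by (auto simp: contravariant_form_def)

lemma f_adj: "ip (f m u) w = ip u (e (- m) w)"
  by (metis e_adj ip_cnj minus_minus)

definition is_vacuum :: "'v \<Rightarrow> bool" where
  "is_vacuum v \<longleftrightarrow> (\<forall>x m. m \<le> 0 \<longrightarrow> act x m v = 0)"

context
  fixes v assumes vac: "is_vacuum v"
begin

lemma vac0: "m \<le> 0 \<Longrightarrow> act x m v = 0"
  using vac by (simp add: is_vacuum_def)

lemma ip_e_e_vac: "l > 0 \<Longrightarrow> ip (e l v) (e l v) = of_int l * ip v v"
  by (simp add: e_adj f_e vac0 ip_scale_right)

lemma ip_h_h_vac: "p > 0 \<Longrightarrow> ip (h p v) (h p v) = 2 * of_int p * ip v v"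
  by (simp add: h_adj h_h[of "-p" p] vac0 ip_scale_right ip_uminus_right ip_diff_right)

lemma ip_e_h_vac:
  assumes "j > 0" "p + j = l"  "l > 0"
  shows "ip (e j (h p v)) (e l v) = (if p > 0 then - 2 * of_int p * ip v v else 0)"
proof (cases "p > 0")
  case True
  have "ip (e j (h p v)) (e l v) = ip (h p v) (f (-j) (e l v))" by (simp add: e_adj)
  also have "f (-j) (e l v) = - h p v"
  proof -
    have "f (-j) (e (p + j) v) = - h p v" using assms(1) True by (simp add: f_e vac0)
    then show ?thesis by (simp only: assms(2))
  qed
  finally show ?thesis using True by (simp add: ip_uminus_right ip_h_h_vac)
qed (simp add: vac0)

text \<open>The four creation operators are contracted by moving \<open>f (-k)\<close>, the adjoint of \<open>e k\<close>, through
\<open>e i\<close> and \<open>e j\<close>. The terms with \<open>max\<close> arise because the modes \<open>h (i - k)\<close> and \<open>h (j - k)\<close>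
left over kill the vacuum unless they are positive.\<close>

lemma gram_vac:
  assumes "i > 0" "j > 0" "k > 0" "l > 0" "i + j = k + l"
  shows "ip (e i (e j v)) (e k (e l v))
    = (of_int ((if i = k then k * l else 0) + (if j = k then k * l else 0) - 2 * l
        + 2 * max 0 (i - k) + 2 * max 0 (j - k))) * ip v v"
proof -
  have "ip (e i (e j v)) (e k (e l v)) = ip (f (-k) (e i (e j v))) (e l v)"
    by (simp add: f_adj)
  also have "f (-k) (e i (e j v)) = e i (sc (if j = k then of_int j else 0) v)
      - e i (h (j - k) v) - (sc 2 (e l v) + e j (h (i - k) v))
      + sc (if i = k then of_int i else 0) (e j v)"
  proof -
    have 1: "f (-k) (e j v) = sc (if j = k then of_int j else 0) v - h (j - k) v"
      using assms by (simp add: f_e vac0)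
    have 2: "h (i - k) (e j v) = sc 2 (e l v) + e j (h (i - k) v)"
    proof -
      have "i - k + j = l" using assms by simp
      then show ?thesis by (simp add: h_e add.commute)
    qed
    show ?thesis using assms
      by (simp add: f_e[of "-k" i "e j v"] 1 2 act_diff act_scale)
  qed
  also have "ip \<dots> (e l v) = (if j = k then of_int j * ip (e i v) (e l v) else 0)
     - ip (e i (h (j - k) v)) (e l v) - 2 * ip (e l v) (e l v) - ip (e j (h (i - k) v)) (e l v)
     + (if i = k then of_int i * ip (e j v) (e l v) else 0)"
    by (simp add: ip_add ip_diff ip_scale act_scale)
  also have "\<dots> = (of_int ((if i = k then k * l else 0) + (if j = k then k * l else 0) - 2 * l
        + 2 * max 0 (i - k) + 2 * max 0 (j - k))) * ip v v"
  proof -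
    have a: "ip (e i (h (j - k) v)) (e l v) = (if j - k > 0 then - 2 * of_int (j-k) * ip v v else 0)"
      by (rule ip_e_h_vac) (use assms in auto)
    have b: "ip (e j (h (i - k) v)) (e l v) = (if i - k > 0 then - 2 * of_int (i-k) * ip v v else 0)"
      by (rule ip_e_h_vac) (use assms in auto)
    have c: "j = k \<Longrightarrow> i = l" "i = k \<Longrightarrow> j = l" using assms by auto
    show ?thesis
      unfolding a b using assms c by (auto simp: ip_e_e_vac max_def algebra_simps)
  qed
  finally show ?thesis .
qed

lemma sum_positive_parts:
  fixes k l :: int assumes "k > 0" "l > 0"
  shows "(\<Sum>i\<in>{1..k+l-1}. max 0 (i - k)) * 2 = l * (l - 1)"
proof -
  have "l \<ge> 1" using assms by simp
  then show ?thesis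
  proof (induction l rule: int_ge_induct)
    case base
    have "(\<Sum>i\<in>{1..k+1-1}. max 0 (i - k)) = 0" by (rule sum.neutral) auto
    then show ?case by simp
  next
    case (step l)
    have "{1..k+(l+1)-1} = insert (k+l) {1..k+l-1}" using assms step by auto
    then have "(\<Sum>i\<in>{1..k+(l+1)-1}. max 0 (i - k)) = l + (\<Sum>i\<in>{1..k+l-1}. max 0 (i - k))"
      using step by simp
    then show ?case using step by (simp add: algebra_simps)
  qed
qed

text \<open>At level one the row sums of the Gram matrix in \<open>gram_vac\<close> vanish: they equal
\<open>2 k l - 2 l (m - 1) + 2 l (l - 1)\<close> with \<open>k + l = m\<close>. So the sum of all the \<open>e i (e (m - i) v)\<close> is
orthogonal to each of its summands, hence to itself.\<close>

lemma e_square_vac: "(\<Sum>i\<in>{1..m-1}. e i (e (m - i) v)) = 0" (is "?E = 0")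
proof (rule ip_self_zero)
  have "ip ?E (e k (e (m - k) v)) = 0" if k: "k \<in> {1..m-1}" for k
  proof -
    define l where "l = m - k"
    have kl: "k > 0" "l > 0" "m = k + l" using k by (auto simp: l_def)
    let ?g = "\<lambda>i j. (if i = k then k * l else 0) + (if j = k then k * l else 0) - 2 * l
        + 2 * max 0 (i - k) + 2 * max 0 (j - k)"
    have "ip ?E (e k (e l v)) = (\<Sum>i\<in>{1..m-1}. of_int (?g i (m - i)) * ip v v)"
      unfolding ip_sum by (intro sum.cong refl gram_vac) (use kl in auto)
    also have "\<dots> = of_int (\<Sum>i\<in>{1..m-1}. ?g i (m - i)) * ip v v"
      by (simp only: of_int_sum sum_distrib_right)
    also have "(\<Sum>i\<in>{1..m-1}. ?g i (m - i)) = (\<Sum>i\<in>{1..m-1}. if i = k then k * l else 0)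
       + (\<Sum>i\<in>{1..m-1}. if m - i = k then k * l else 0) - (\<Sum>i\<in>{1..m-1}. 2 * l)
       + 2 * (\<Sum>i\<in>{1..m-1}. max 0 (i - k)) + 2 * (\<Sum>i\<in>{1..m-1}. max 0 ((m - i) - k))"
      by (simp only: sum.distrib sum_subtractf sum_distrib_left)
    also have "(\<Sum>i\<in>{1..m-1}. max 0 ((m - i) - k)) = (\<Sum>i\<in>{1..m-1}. max 0 (i - k))"
      by (rule sum.reindex_bij_witness[of _ "\<lambda>i. m - i" "\<lambda>i. m - i"]) auto
    also have "(\<Sum>i\<in>{1..m-1}. if m - i = k then k * l else 0)
        = (\<Sum>i\<in>{1..m-1}. if i = k then k * l else 0)"
      by (rule sum.reindex_bij_witness[of _ "\<lambda>i. m - i" "\<lambda>i. m - i"]) auto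
    also have "(\<Sum>i\<in>{1..m-1}. if i = k then k * l else 0) = k * l"
      using k by simp
    finally have "ip ?E (e k (e l v)) = of_int (k * l + k * l - (m - 1) * (2 * l)
       + 2 * (2 * (\<Sum>i\<in>{1..m-1}. max 0 (i - k)))) * ip v v"
      using k by simp
    also have "2 * (\<Sum>i\<in>{1..m-1}. max 0 (i - k)) = l * (l - 1)"
      using sum_positive_parts[of k l] kl by simp
    also have "k * l + k * l - (m - 1) * (2 * l) + 2 * (l * (l - 1)) = 0"
      using kl by (simp add: algebra_simps)
    finally show ?thesis by (simp add: l_def)
  qed
  then show "ip ?E ?E = 0" by (simp add: ip_sum_right)
qed

end

section \<open>Spectral flow and extremal vectors\<close>

text \<open>The composition of the action with an automorphism of the affine algebra: a translation in the extended
affine Weyl group, by \<open>N\<close> times half the coroot. It preserves the involution, and therefore the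
contravariance of the form.\<close>

definition spectral_flow :: "int \<Rightarrow> sl2 \<Rightarrow> int \<Rightarrow> 'v \<Rightarrow> 'v" where
  "spectral_flow N x m v = (case x of Esl \<Rightarrow> e (m - N) v | Fsl \<Rightarrow> f (m + N) v
     | Hsl \<Rightarrow> h m v + sc (if m = 0 then of_int N else 0) v)"

lemma spectral_flow_simps [simp]:
  "spectral_flow N Esl m v = e (m - N) v"
  "spectral_flow N Fsl m v = f (m + N) v"
  "spectral_flow N Hsl m v = h m v + sc (if m = 0 then of_int N else 0) v"
  by (simp_all add: spectral_flow_def)

lemma linearI: "(\<And>u w. g (u + w) = g u + g w) \<Longrightarrow> (\<And>c u. g (sc c u) = sc c (g u)) \<Longrightarrow>
    Vector_Spaces.linear sc sc g"
  by (simp add: Vector_Spaces.linear_iff vector_space_axioms)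

lemma unitary_level_one_spectral_flow: "unitary_level_one sc (spectral_flow N) ip"
proof (unfold_locales)
  show "affine_sl2_rep sc 1 (spectral_flow N)"
    unfolding affine_sl2_rep_def
  proof (intro conjI allI)
    fix x m
    show "Vector_Spaces.linear sc sc (spectral_flow N x m)"
      by (rule linearI; cases x)
         (auto simp: act_add act_scale scale_right_distrib algebra_simps)
  next
    fix m l v
    have [simp]: "m - N + (l + N) = m + l" "m + (l - N) = m + l - N" "m + (l + N) = m + l + N" by auto
    show "spectral_flow N Esl m (spectral_flow N Esl l v) - spectral_flow N Esl l (spectral_flow N Esl m v) = 0"
      by (simp add: e_e)
    show "spectral_flow N Fsl m (spectral_flow N Fsl l v) - spectral_flow N Fsl l (spectral_flow N Fsl m v) = 0"
      using rep unfolding affine_sl2_rep_def by simp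
    show "spectral_flow N Hsl m (spectral_flow N Hsl l v) - spectral_flow N Hsl l (spectral_flow N Hsl m v)
          = - sc (if m + l = 0 then 2 * of_int m * 1 else 0) v"
      using h_h[of m l v] by (auto simp: act_add act_scale scale_right_distrib algebra_simps)
    show "spectral_flow N Hsl m (spectral_flow N Esl l v) - spectral_flow N Esl l (spectral_flow N Hsl m v)
          = sc 2 (spectral_flow N Esl (m + l) v)"
      using h_e[of m "l-N" v] by (simp add: act_add act_scale)
    show "spectral_flow N Hsl m (spectral_flow N Fsl l v) - spectral_flow N Fsl l (spectral_flow N Hsl m v)
          = sc (- 2) (spectral_flow N Fsl (m + l) v)"
      using h_f[of m "l+N" v] by (simp add: act_add act_scale)
    show "spectral_flow N Esl m (spectral_flow N Fsl l v) - spectral_flow N Fsl l (spectral_flow N Esl m v)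
       = spectral_flow N Hsl (m + l) v - sc (if m + l = 0 then of_int m * 1 else 0) v"
      using f_e[of "l+N" "m-N" v] by (simp add: scale_left_diff_distrib)
  qed
  show "pos_def_hermitian sc ip" by (rule herm)
  show "contravariant_form (spectral_flow N) ip"
    unfolding contravariant_form_def
    by (auto simp: e_adj h_adj ip_add ip_add_right ip_scale ip_scale_right add.commute)
qed

text \<open>The annihilation properties of \<open>v\<^sub>N\<close>: it is the lowest weight vector, of weight \<open>-N\<close>, in
the \<open>N\<close>-th fusion product.\<close>

definition is_extremal :: "int \<Rightarrow> 'v \<Rightarrow> bool" where
  "is_extremal N v \<longleftrightarrow> (\<forall>i\<ge>N. e (- i) v = 0) \<and> (\<forall>i>0. h (- i) v = 0) \<and> h 0 v = sc (- of_int N) v"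

text \<open>The vector \<open>f N v\<close> has norm 0, because \<open>h 0 v = -N v\<close> cancels the central term \<open>N\<close> in
\<open>[e (-N), f N]\<close>; the smaller modes are obtained from \<open>f N\<close> by bracketing with \<open>h\<close>.\<close>

lemma extremal_f:
  assumes v: "is_extremal N v" and "i \<le> N"
  shows "f i v = 0"
proof -
  have "e (-N) (f N v) = 0"
    using f_e[of N "-N" v] v by (auto simp: is_extremal_def)
  then have "ip (f N v) (f N v) = 0" by (simp add: f_adj)
  then have fN: "f N v = 0" by (rule ip_self_zero)
  show ?thesis
  proof (cases "i = N")
    case False
    then have "h (i - N) v = 0" using v \<open>i \<le> N\<close> by (force simp: is_extremal_def dest: spec[of _ "N - i"])
    then have "sc 2 (f i v) = 0" using h_f[of "i - N" N v] fN by simp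
    then show ?thesis by simp
  qed (simp add: fN)
qed

lemma e_square_extremal:
  assumes v: "is_extremal N v"
  shows "(\<Sum>i\<in>{1-N..m+N-1}. e i (e (m - i) v)) = 0"
proof -
  interpret fl: unitary_level_one sc "spectral_flow N" ip
    by (rule unitary_level_one_spectral_flow)
  \<comment> \<open>Positive modes of \<open>f\<close> up to \<open>N\<close> become nonpositive modes after the flow, which is where
    \<open>extremal_f\<close> enters.\<close>
  have "fl.is_vacuum v"
    unfolding fl.is_vacuum_def
  proof (intro allI impI)
    fix x and m :: int assume m: "m \<le> 0"
    have "e (m - N) v = 0" using v m by (auto simp: is_extremal_def dest: spec[of _ "N - m"])
    moreover have "m \<noteq> 0 \<Longrightarrow> h m v = 0" using v m by (auto simp: is_extremal_def dest: spec[of _ "- m"])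
    moreover have "h 0 v = sc (- of_int N) v" using v by (simp add: is_extremal_def)
    moreover have "f (m + N) v = 0" using extremal_f[OF v] m by simp
    ultimately show "spectral_flow N x m v = 0" by (cases x) auto
  qed
  from fl.e_square_vac[OF this, of "m + 2 * N"]
  have "(\<Sum>i\<in>{1..m+2*N-1}. e (i - N) (e (m - (i - N)) v)) = 0"
    by (simp add: algebra_simps)
  also have "(\<Sum>i\<in>{1..m+2*N-1}. e (i - N) (e (m - (i - N)) v)) = (\<Sum>i\<in>{1-N..m+N-1}. e i (e (m - i) v))"
    by (rule sum.reindex_bij_witness[of _ "\<lambda>i. i + N" "\<lambda>i. i - N"]) auto
  finally show ?thesis .
qed

section \<open>The square of the current and the operator \<open>L\<^sub>0\<close>\<close>

definition L0 :: "'v \<Rightarrow> 'v" where "L0 = vir sc act 0"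

text \<open>Smoothness makes the infinite sums over modes finite.\<close>

definition smooth :: "'v \<Rightarrow> bool" where
  "smooth v \<longleftrightarrow> (\<forall>\<^sub>F B in sequentially. \<forall>i\<ge>int B. e (- i) v = 0 \<and> h (- i) v = 0)"

text \<open>The vector is annihilated by all modes of the square of the current \<open>e(x)\<close>. Summing over large intervals
symmetric about \<open>m / 2\<close>, instead of over the support of the summand, makes the condition linear in
\<open>v\<close> and leaves it unchanged under the reflection \<open>i \<mapsto> m - i\<close>.\<close>

definition e_square_null :: "'v \<Rightarrow> bool" where
  "e_square_null v \<longleftrightarrow>
     (\<forall>m. \<forall>\<^sub>F B in sequentially. (\<Sum>i\<in>{- int B..m + int B}. e i (e (m - i) v)) = 0)"

lemma subspace_smooth: "subspace {v. smooth v}"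
proof (rule subspaceI; clarsimp simp: smooth_def)
  fix x y assume "\<forall>\<^sub>F B in sequentially. \<forall>i\<ge>int B. e (- i) x = 0 \<and> h (- i) x = 0"
    "\<forall>\<^sub>F B in sequentially. \<forall>i\<ge>int B. e (- i) y = 0 \<and> h (- i) y = 0"
  then show "\<forall>\<^sub>F B in sequentially. \<forall>i\<ge>int B. e (- i) (x + y) = 0 \<and> h (- i) (x + y) = 0"
    by eventually_elim (simp add: act_add)
next
  fix c x assume "\<forall>\<^sub>F B in sequentially. \<forall>i\<ge>int B. e (- i) x = 0 \<and> h (- i) x = 0"
  then show "\<forall>\<^sub>F B in sequentially. \<forall>i\<ge>int B. e (- i) (sc c x) = 0 \<and> h (- i) (sc c x) = 0"
    by eventually_elim (simp add: act_scale)
qed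

lemma smooth_iff: "smooth v \<longleftrightarrow> (\<exists>B. \<forall>i\<ge>B. e (- i) v = 0 \<and> h (- i) v = 0)"
proof
  assume "\<exists>B. \<forall>i\<ge>B. e (- i) v = 0 \<and> h (- i) v = 0"
  then obtain B where B: "\<forall>i\<ge>B. e (- i) v = 0 \<and> h (- i) v = 0" by blast
  show "smooth v"
    unfolding smooth_def eventually_sequentially
    by (rule exI[of _ "nat B"]) (use B in auto)
qed (force simp: smooth_def eventually_sequentially)

lemma smooth_e:
  assumes "smooth v" shows "smooth (e p v)"
proof -
  obtain B where B: "\<forall>i\<ge>B. e (- i) v = 0 \<and> h (- i) v = 0" using assms by (auto simp: smooth_iff)
  have "\<forall>i\<ge>max B (B + p). e (- i) (e p v) = 0 \<and> h (- i) (e p v) = 0"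
  proof (intro allI impI)
    fix i assume i: "i \<ge> max B (B + p)"
    have "e (- i + p) v = 0" using B[rule_format, of "i - p"] i by simp
    then show "e (- i) (e p v) = 0 \<and> h (- i) (e p v) = 0"
      using B i by (simp add: e_e[of "-i" p] h_e)
  qed
  then show ?thesis unfolding smooth_iff by blast
qed

lemma subspace_e_square_null: "subspace {v. e_square_null v}"
proof (rule subspaceI; clarsimp simp: e_square_null_def)
  fix x y and m :: int
  assume "\<forall>m. \<forall>\<^sub>F B in sequentially. (\<Sum>i\<in>{- int B..m + int B}. e i (e (m - i) x)) = 0"
    "\<forall>m. \<forall>\<^sub>F B in sequentially. (\<Sum>i\<in>{- int B..m + int B}. e i (e (m - i) y)) = 0"
  then have "\<forall>\<^sub>F B in sequentially. (\<Sum>i\<in>{- int B..m + int B}. e i (e (m - i) x)) = 0"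
    "\<forall>\<^sub>F B in sequentially. (\<Sum>i\<in>{- int B..m + int B}. e i (e (m - i) y)) = 0" by auto
  then show "\<forall>\<^sub>F B in sequentially. (\<Sum>i\<in>{- int B..m + int B}. e i (e (m - i) (x + y))) = 0"
    by eventually_elim (simp add: act_add sum.distrib)
next
  fix c x and m :: int
  assume "\<forall>m. \<forall>\<^sub>F B in sequentially. (\<Sum>i\<in>{- int B..m + int B}. e i (e (m - i) x)) = 0"
  then have "\<forall>\<^sub>F B in sequentially. (\<Sum>i\<in>{- int B..m + int B}. e i (e (m - i) x)) = 0" by auto
  then show "\<forall>\<^sub>F B in sequentially. (\<Sum>i\<in>{- int B..m + int B}. e i (e (m - i) (sc c x))) = 0"
    by eventually_elim (simp add: act_scale scale_sum_right[symmetric])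
qed

text \<open>The modes of \<open>e(x)\<close> commute with each other.\<close>

lemma e_square_null_e:
  assumes "e_square_null v" shows "e_square_null (e p v)"
proof -
  have *: "e i (e j (e p v)) = e p (e i (e j v))" for i j
    by (simp add: e_e[of i p] e_e[of j p])
  have **: "(\<Sum>i\<in>A. e i (e (m - i) (e p v))) = e p (\<Sum>i\<in>A. e i (e (m - i) v))" for A m
    by (simp only: * act_sum)
  show ?thesis
    unfolding e_square_null_def **
  proof
    fix m
    have "\<forall>\<^sub>F B in sequentially. (\<Sum>i\<in>{- int B..m + int B}. e i (e (m - i) v)) = 0"
      using assms by (simp add: e_square_null_def)
    then show "\<forall>\<^sub>F B in sequentially. e p (\<Sum>i\<in>{- int B..m + int B}. e i (e (m - i) v)) = 0"
      by eventually_elim simp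
  qed
qed

lemma extremal_smooth: "is_extremal N v \<Longrightarrow> smooth v"
  unfolding smooth_iff is_extremal_def by (rule exI[of _ "max 1 N"]) auto

lemma extremal_e_square_null:
  assumes v: "is_extremal N v" shows "e_square_null v"
  unfolding e_square_null_def
proof
  fix m
  have "(\<Sum>i\<in>{- int B..m + int B}. e i (e (m - i) v)) = 0" if B: "nat \<bar>N\<bar> \<le> B" for B
  proof -
    have "(\<Sum>i\<in>{- int B..m + int B}. e i (e (m - i) v)) = (\<Sum>i\<in>{1-N..m+N-1}. e i (e (m - i) v))"
    proof (rule sum.mono_neutral_right)
      show "\<forall>i\<in>{- int B..m + int B} - {1-N..m+N-1}. e i (e (m - i) v) = 0"
      proof
        fix i assume "i \<in> {- int B..m + int B} - {1-N..m+N-1}"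
        then consider "- i \<ge> N" | "i - m \<ge> N" by force
        then show "e i (e (m - i) v) = 0"
        proof cases
          case 1
          then have "e i v = 0" using v by (auto simp: is_extremal_def dest!: spec[of _ "- i"])
          then show ?thesis by (simp add: e_e[of i])
        next
          case 2
          then have "e (m - i) v = 0" using v by (auto simp: is_extremal_def dest!: spec[of _ "i - m"])
          then show ?thesis by simp
        qed
      qed
    qed (use B in auto)
    then show ?thesis using e_square_extremal[OF v] by simp
  qed
  then show "\<forall>\<^sub>F B in sequentially. (\<Sum>i\<in>{- int B..m + int B}. e i (e (m - i) v)) = 0"
    unfolding eventually_sequentially by blast
qed

text \<open>The factor in \<open>a\<^sub>m = h (-m) / \<surd>2\<close> contributes \<open>1/2\<close> to every quadratic term.\<close>

lemma L0_finite_sum: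
  assumes B: "\<And>i. i > B \<Longrightarrow> h (- i) v = 0"
  shows "L0 v = sc (1/4) (h 0 (h 0 v)) + sc (1/2) (\<Sum>j\<in>{1..B}. h j (h (- j) v))"
proof -
  have half: "1 / complex_of_real (sqrt 2) * (1 / complex_of_real (sqrt 2)) = 1 / 2"
    by (simp flip: of_real_mult)
  have aa: "heis sc act (- j) (heis sc act j v) = sc (1/2) (h j (h (- j) v))" for j
    unfolding heis_def by (simp only: act_scale scale_scale half minus_minus)
  have "Sum_any (\<lambda>j::int. if 1 \<le> j then heis sc act (- j) (heis sc act j v) else 0)
     = (\<Sum>j\<in>{1..B}. if 1 \<le> j then heis sc act (- j) (heis sc act j v) else 0)"
  proof (rule Sum_any.expand_superset)
    show "{j. (if 1 \<le> j then heis sc act (- j) (heis sc act j v) else 0) \<noteq> 0} \<subseteq> {1..B}"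
    proof clarify
      fix j assume "(if 1 \<le> j then heis sc act (- j) (heis sc act j v) else 0) \<noteq> 0"
      then have "1 \<le> j" "h (- j) v \<noteq> 0" by (auto simp: aa split: if_splits)
      then show "j \<in> {1..B}" using B[of j] by force
    qed
  qed simp
  also have "\<dots> = (\<Sum>j\<in>{1..B}. sc (1/2) (h j (h (- j) v)))"
    by (intro sum.cong) (auto simp: aa)
  finally show ?thesis
    using aa[of 0] by (simp add: L0_def vir_def Let_def scale_sum_right)
qed

lemma L0_add: assumes "smooth v" "smooth w" shows "L0 (v + w) = L0 v + L0 w"
proof -
  obtain B B' where B: "\<forall>i\<ge>B. e (- i) v = 0 \<and> h (- i) v = 0" "\<forall>i\<ge>B'. e (- i) w = 0 \<and> h (- i) w = 0"
    using assms by (auto simp: smooth_iff)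
  have "h (- i) v = 0" "h (- i) w = 0" "h (- i) (v + w) = 0" if "i > max B B'" for i
    using B that by (auto simp: act_add)
  note L0_finite_sum[of "max B B'", OF this(1)] L0_finite_sum[of "max B B'", OF this(2)]
    L0_finite_sum[of "max B B'", OF this(3)]
  then show ?thesis by (simp add: act_add scale_right_distrib sum.distrib)
qed

lemma L0_scale: assumes "smooth v" shows "L0 (sc c v) = sc c (L0 v)"
proof -
  obtain B where B: "\<forall>i\<ge>B. e (- i) v = 0 \<and> h (- i) v = 0"
    using assms by (auto simp: smooth_iff)
  have "h (- i) v = 0" "h (- i) (sc c v) = 0" if "i > B" for i
    using B that by (auto simp: act_scale)
  note L0_finite_sum[of B, OF this(1)] L0_finite_sum[of B, OF this(2)]
  then show ?thesis by (simp add: act_scale scale_right_distrib scale_sum_right[symmetric] scale_left_commute)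
qed

lemma L0_extremal: 
  assumes "is_extremal N v"
  shows "L0 v = sc (of_int (N * N) / 4) v"
proof -
  have "L0 v = sc (1/4) (h 0 (h 0 v)) + sc (1/2) (\<Sum>j\<in>{1..0}. h j (h (- j) v))"
    by (rule L0_finite_sum) (use assms in \<open>auto simp: is_extremal_def\<close>)
  then show ?thesis using assms by (simp add: is_extremal_def act_uminus act_scale)
qed

text \<open>This is the commutator of \<open>f 0\<close> with the square of \<open>e(x)\<close>, after the reflection \<open>i \<mapsto> m - i\<close> in
one of the two sums. The mode \<open>f 0\<close> is used because its commutators with the \<open>e m\<close> have no central
term.\<close>

lemma h_e_normal_order:
  assumes null: "\<And>w. e_square_null w"
  shows "\<forall>\<^sub>F B in sequentially. (\<Sum>i\<in>{- int B..m + int B}. h i (e (m - i) v) + e (m - i) (h i v)) = 0"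
proof -
  have "\<forall>\<^sub>F B in sequentially. (\<Sum>i\<in>{- int B..m + int B}. e i (e (m - i) v)) = 0"
    "\<forall>\<^sub>F B in sequentially. (\<Sum>i\<in>{- int B..m + int B}. e i (e (m - i) (f 0 v))) = 0"
    using null by (auto simp: e_square_null_def)
  then show ?thesis
  proof eventually_elim
    case (elim B)
    have fe: "f 0 (e i w) = e i (f 0 w) - h i w" for i w
      by (simp add: f_e)
    have "0 = f 0 (\<Sum>i\<in>{- int B..m + int B}. e i (e (m - i) v))
        - (\<Sum>i\<in>{- int B..m + int B}. e i (e (m - i) (f 0 v)))" using elim by simp
    also have "\<dots> = - ((\<Sum>i\<in>{- int B..m + int B}. h i (e (m - i) v))
        + (\<Sum>i\<in>{- int B..m + int B}. e i (h (m - i) v)))"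
      by (simp add: act_sum fe act_diff sum_subtractf)
    also have "(\<Sum>i\<in>{- int B..m + int B}. e i (h (m - i) v)) = (\<Sum>i\<in>{- int B..m + int B}. e (m - i) (h i v))"
      by (rule sum.reindex_bij_witness[of _ "\<lambda>i. m - i" "\<lambda>i. m - i"]) auto
    finally have "(\<Sum>i\<in>{- int B..m + int B}. h i (e (m - i) v))
        + (\<Sum>i\<in>{- int B..m + int B}. e (m - i) (h i v)) = 0"
      by (metis neg_0_equal_iff_equal)
    then show ?case by (simp only: sum.distrib)
  qed
qed

lemma sum_int_split:
  fixes g :: "int \<Rightarrow> 'v" assumes "a \<ge> 0" "b \<ge> 0"
  shows "sum g {- a..b} = sum g {- a..-1} + g 0 + sum g {1..b}"
proof -
  have 1: "{- a..b} = {- a..-1} \<union> {0..b}" "{0..b} = insert 0 {1..b}" using assms by auto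
  have "sum g ({- a..-1} \<union> {0..b}) = sum g {- a..-1} + sum g {0..b}"
    by (rule sum.union_disjoint) auto
  then show ?thesis unfolding 1 by (simp add: add.assoc)
qed

text \<open>The sum in \<open>h_e_normal_order\<close> is brought into normal order. For \<open>i > 0\<close> the mode \<open>h i\<close> is moved
to the left, at the cost of \<open>-2 (e m)\<close> for each of \<open>m + B\<close> indices; for \<open>i < 0\<close> it is moved to the
right, at the cost of \<open>2 (e m)\<close> for each of \<open>B\<close> indices. The surplus \<open>-2m (e m)\<close> is the
anomaly that produces the eigenvalue.\<close>

lemma L0_e:
  assumes null: "\<And>w. e_square_null w" and sm: "smooth v"
  shows "L0 (e m v) = e m (L0 v) + sc (of_int m) (e m v)"
proof -
  obtain B0 where B0: "\<And>i. i \<ge> B0 \<Longrightarrow> e (- i) v = 0" "\<And>i. i \<ge> B0 \<Longrightarrow> h (- i) v = 0"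
    using sm by (auto simp: smooth_iff)
  obtain B1 where B1: "\<And>i. i \<ge> B1 \<Longrightarrow> h (- i) (e m v) = 0"
    using smooth_e[OF sm, of m] by (auto simp: smooth_iff)
  obtain B2 where B2: "\<And>B. B \<ge> B2 \<Longrightarrow>
      (\<Sum>i\<in>{- int B..m + int B}. h i (e (m - i) v) + e (m - i) (h i v)) = 0"
    using h_e_normal_order[OF null, of m v] unfolding eventually_sequentially by blast
  \<comment> \<open>A cutoff beyond which all tails of the sums vanish, including those shifted by \<open>m\<close>.\<close>
  define n where "n = max B2 (nat (\<bar>B0\<bar> + \<bar>B1\<bar> + \<bar>m\<bar> + 1))"
  define B where "B = int n"
  have B: "B \<ge> B0 + \<bar>m\<bar>" "B \<ge> B1" "B \<ge> 0" "B + m \<ge> 0" "n \<ge> B2" "B \<ge> B0"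
    unfolding B_def n_def by linarith+
  have L: "L0 v = sc (1/4) (h 0 (h 0 v)) + sc (1/2) (\<Sum>j\<in>{1..B}. h j (h (- j) v))"
    "L0 (e m v) = sc (1/4) (h 0 (h 0 (e m v))) + sc (1/2) (\<Sum>j\<in>{1..B}. h j (h (- j) (e m v)))"
    by (rule L0_finite_sum; use B B0 B1 in force)+
  have he: "h j (h (- j) (e m v)) = e m (h j (h (- j) v)) + (sc 2 (h j (e (m - j) v)) + sc 2 (e (m + j) (h (- j) v)))" for j
  proof -
    have 1: "h (- j) (e m v) = e m (h (- j) v) + sc 2 (e (m - j) v)" using h_e[of "-j" m v] by simp
    have 2: "h j (e m (h (- j) v)) = e m (h j (h (- j) v)) + sc 2 (e (m + j) (h (- j) v))"
      using h_e[of j m] by (simp add: add.commute)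
    show ?thesis by (simp only: 1 2 act_add act_scale add.assoc add.commute[of "sc 2 (h j (e (m - j) v))"])
  qed
  have h0: "h 0 (h 0 (e m v)) = e m (h 0 (h 0 v)) + (sc 2 (h 0 (e m v)) + sc 2 (e m (h 0 v)))"
    using he[of 0] by simp
  let ?X = "\<Sum>j\<in>{1..B}. h j (e (m - j) v)"
  let ?Y = "\<Sum>j\<in>{1..B}. e (m + j) (h (- j) v)"
  let ?g = "\<lambda>i. h i (e (m - i) v) + e (m - i) (h i v)"
  have comm: "L0 (e m v) - e m (L0 v) = sc (1/2) (h 0 (e m v) + e m (h 0 v)) + (?X + ?Y)"
    unfolding L he h0
    by (simp add: act_add act_scale act_sum scale_right_distrib sum.distrib scale_sum_right)
  have "sum ?g {- B..m + B} = sum ?g {- B..-1} + ?g 0 + sum ?g {1..m + B}"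
    by (rule sum_int_split) (use B in auto)
  also have "sum ?g {1..m + B} = sc 2 ?X - sc (2 * of_int (m + B)) (e m v)"
  proof -
    have "?g i = sc 2 (h i (e (m - i) v)) - sc 2 (e m v)" for i
    proof -
      have "h i (e (m - i) v) = e (m - i) (h i v) + sc 2 (e m v)" by (simp add: h_e)
      then have "e (m - i) (h i v) = h i (e (m - i) v) - sc 2 (e m v)" by simp
      moreover have "sc 2 x = x + x" for x using scale_left_distrib[of 1 1 x] by simp
      ultimately show ?thesis by simp
    qed
    then have "sum ?g {1..m + B} = sc 2 (\<Sum>i\<in>{1..m + B}. h i (e (m - i) v)) - (\<Sum>i\<in>{1..m + B}. sc 2 (e m v))"
      by (simp add: sum_subtractf scale_sum_right)
    also have "(\<Sum>i\<in>{1..m + B}. sc 2 (e m v)) = sc (2 * of_int (m + B)) (e m v)"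
      using B by (simp add: sum_constant_scale mult.commute)
    also have "(\<Sum>i\<in>{1..m + B}. h i (e (m - i) v)) = (\<Sum>i\<in>{1..min B (m + B)}. h i (e (m - i) v))"
    proof (rule sum.mono_neutral_right)
      show "\<forall>i\<in>{1..m + B} - {1..min B (m + B)}. h i (e (m - i) v) = 0"
      proof
        fix i assume "i \<in> {1..m + B} - {1..min B (m + B)}"
        then have "i - m \<ge> B0" using B by auto
        then show "h i (e (m - i) v) = 0" using B0(1)[of "i - m"] by simp
      qed
    qed auto
    also have "\<dots> = ?X"
    proof (rule sum.mono_neutral_left)
      show "\<forall>i\<in>{1..B} - {1..min B (m + B)}. h i (e (m - i) v) = 0"
      proof
        fix i assume "i \<in> {1..B} - {1..min B (m + B)}"
        then have "i - m \<ge> B0" using B by auto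
        then show "h i (e (m - i) v) = 0" using B0(1)[of "i - m"] by simp
      qed
    qed auto
    finally show ?thesis .
  qed
  also have "sum ?g {- B..-1} = sc 2 ?Y + sc (2 * of_int B) (e m v)"
  proof -
    have "sum ?g {- B..-1} = (\<Sum>j\<in>{1..B}. ?g (- j))"
      by (rule sum.reindex_bij_witness[of _ "\<lambda>i. - i" "\<lambda>i. - i"]) auto
    also have "\<dots> = (\<Sum>j\<in>{1..B}. sc 2 (e (m + j) (h (- j) v)) + sc 2 (e m v))"
    proof (rule sum.cong[OF refl])
      fix j
      have "sc 2 x = x + x" for x using scale_left_distrib[of 1 1 x] by simp
      then show "?g (- j) = sc 2 (e (m + j) (h (- j) v)) + sc 2 (e m v)" by (simp add: h_e)
    qed
    also have "\<dots> = sc 2 ?Y + sc (2 * of_int B) (e m v)"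
      using B by (simp add: sum.distrib scale_sum_right sum_constant_scale mult.commute)
    finally show ?thesis .
  qed
  finally have "sum ?g {- B..m + B} = (sc 2 ?Y + sc (2 * of_int B) (e m v)) + ?g 0
      + (sc 2 ?X - sc (2 * of_int (m + B)) (e m v))" .
  moreover have "sum ?g {- B..m + B} = 0" using B2[of n] B by (simp add: B_def)
  moreover have "sc (2 * of_int (m + B)) (e m v) = sc 2 (sc (of_int m) (e m v)) + sc (2 * of_int B) (e m v)"
    by (simp add: scale_left_distrib[symmetric] distrib_left)
  ultimately have "sc 2 (sc (of_int m) (e m v)) = sc 2 ?Y + ?g 0 + sc 2 ?X"
    by (rule cancel_common_term)
  then have "sc (1/2) (sc 2 (sc (of_int m) (e m v))) = sc (1/2) (sc 2 ?Y + ?g 0 + sc 2 ?X)"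
    by (simp only:)
  then have "sc (of_int m) (e m v) = ?Y + sc (1/2) (?g 0) + ?X"
    by (simp only: scale_right_distrib scale_scale) simp
  then show ?thesis using comm by (simp add: algebra_simps)
qed

end

section \<open>The currents\<close>

text \<open>The currents are sums of these one-site operators, weighted by powers of the evaluation points.\<close>

definition site :: "sl2 \<Rightarrow> nat \<Rightarrow> spin \<Rightarrow> spin" where
  "site x s = lin_ext (site_act s x)"

lemma site_linear: "site x s (u + w) = site x s u + site x s w"
    "site x s (fscale c u) = fscale c (site x s u)"
    "site x s 0 = 0" "site x s (sum g A) = (\<Sum>a\<in>A. site x s (g a))"
  by (simp_all add: site_def lin_ext_add lin_ext_scale lin_ext_sum)

lemma current_linear: "current z N x i (u + w) = current z N x i u + current z N x i w"
    "current z N x i (fscale c u) = fscale c (current z N x i u)"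
    "current z N x i 0 = 0" "current z N x i (sum g A) = (\<Sum>a\<in>A. current z N x i (g a))"
  by (simp_all add: current_def lin_ext_add lin_ext_scale lin_ext_sum)

lemma current_eq_site: "current z N x i w = (\<Sum>s<N. fscale (z s ^ i) (site x s w))"
  by (rule linear_eq_from_basis)
    (simp_all add: current_linear site_linear site_def lin_ext_add lin_ext_scale current_def
      fv.scale_right_distrib fv.scale_sum_right sum.distrib mult.commute)

lemma site_h_e: "site Hsl t (site Esl s w)
    = site Esl s (site Hsl t w) + (if s = t then fscale 2 (site Esl s w) else 0)"
proof (rule linear_eq_from_basis[of "\<lambda>w. site Hsl t (site Esl s w)"
      "\<lambda>w. site Esl s (site Hsl t w) + (if s = t then fscale 2 (site Esl s w) else 0)"])
  fix S :: "nat set"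
  have "Poly_Mapping.single a (- 1) + Poly_Mapping.single a 2 = (basis_vec a :: spin)" for a
    by (simp add: single_add[symmetric])
  then show "site Hsl t (site Esl s (basis_vec S)) = site Esl s (site Hsl t (basis_vec S))
      + (if s = t then fscale 2 (site Esl s (basis_vec S)) else 0)"
    by (auto simp: site_def)
qed (auto simp: site_linear fv.scale_right_distrib mult.commute)

lemma current_h_e: "current z N Hsl i (current z N Esl j w)
    = current z N Esl j (current z N Hsl i w) + fscale 2 (current z N Esl (i + j) w)"
proof -
  have "current z N Hsl i (current z N Esl j w)
      = (\<Sum>t<N. \<Sum>s<N. fscale (z t ^ i * z s ^ j) (site Hsl t (site Esl s w)))"
    by (simp add: current_eq_site site_linear fv.scale_sum_right)
  also have "\<dots> = (\<Sum>t<N. \<Sum>s<N. fscale (z t ^ i * z s ^ j) (site Esl s (site Hsl t w)))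
      + (\<Sum>t<N. \<Sum>s<N. if s = t then fscale (z t ^ i * z s ^ j) (fscale 2 (site Esl s w)) else 0)"
    unfolding sum.distrib[symmetric]
    by (intro sum.cong refl) (auto simp: site_h_e fv.scale_right_distrib)
  also have "(\<Sum>t<N. \<Sum>s<N. if s = t then fscale (z t ^ i * z s ^ j) (fscale 2 (site Esl s w)) else 0)
      = fscale 2 (current z N Esl (i + j) w)"
    by (simp add: current_eq_site fv.scale_sum_right power_add mult.commute mult.left_commute)
  also have "(\<Sum>t<N. \<Sum>s<N. fscale (z t ^ i * z s ^ j) (site Esl s (site Hsl t w)))
      = current z N Esl j (current z N Hsl i w)"
    by (subst sum.swap) (simp add: current_eq_site site_linear fv.scale_sum_right mult.commute)
  finally show ?thesis .
qed

lemma current_h_cyclic: "current z N Hsl i cyclic_vec = fscale (- (\<Sum>s<N. z s ^ i)) cyclic_vec"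
proof -
  have "site Hsl s cyclic_vec = fscale (- 1) cyclic_vec" for s
    by (simp add: site_def cyclic_vec_def)
  then have "current z N Hsl i cyclic_vec = (\<Sum>s<N. fscale (- (z s ^ i)) cyclic_vec)"
    by (simp only: current_eq_site fv.scale_scale) simp
  then show ?thesis by (simp only: fv.scale_sum_left[symmetric] sum_negf)
qed

text \<open>Division with remainder by the polynomial with roots \<open>z 0, \<dots>, z (N - 1)\<close>.\<close>

lemma power_reduction:
  fixes z :: "nat \<Rightarrow> complex"
  assumes "N \<le> i"
  obtains c where "\<And>s. s < N \<Longrightarrow> z s ^ i = (\<Sum>k<i. c k * z s ^ k)"
proof -
  define q where "q = monom 1 (i - N) * (\<Prod>s<N. [:- z s, 1:])"
  have "degree (\<Prod>s<N. [:- z s, 1:]) = N"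
    by (subst degree_prod_eq_sum_degree) auto
  moreover have lc: "lead_coeff (\<Prod>s<N. [:- z s, 1:]) = 1"
    by (simp add: lead_coeff_prod)
  moreover have "(\<Prod>s<N. [:- z s, 1:]) \<noteq> 0" by simp
  ultimately have deg: "degree q = i"
    unfolding q_def using assms by (subst degree_mult_eq) (auto simp: degree_monom_eq monom_eq_0_iff)
  have "lead_coeff q = 1" unfolding q_def lead_coeff_mult lc by (simp add: degree_monom_eq)
  then have "poly q x = (\<Sum>k<i. coeff q k * x ^ k) + x ^ i" for x
    unfolding poly_altdef deg by (simp add: lessThan_Suc_atMost[symmetric] deg)
  moreover have "poly q (z s) = 0" if "s < N" for s
    using that by (auto simp: q_def poly_prod)
  ultimately have "(\<Sum>k<i. coeff q k * z s ^ k) + z s ^ i = 0" if "s < N" for s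
    using that by metis
  then have "z s ^ i = - (\<Sum>k<i. coeff q k * z s ^ k)" if "s < N" for s
    unfolding eq_neg_iff_add_eq_0 using that by (simp only: add.commute)
  then have "z s ^ i = (\<Sum>k<i. - coeff q k * z s ^ k)" if "s < N" for s
    using that by (simp add: sum_negf)
  then show ?thesis by (rule that)
qed

section \<open>The filtration\<close>

lemma subspace_filt: "fv.subspace (filt z N m)"
  by (simp add: filt_def)

lemma filt_mono: "m \<le> m' \<Longrightarrow> filt z N m \<subseteq> filt z N m'"
  unfolding filt_def by (rule fv.span_mono) force

lemmas filt_add = fv.subspace_add[OF subspace_filt]
lemmas filt_scale = fv.subspace_scale[OF subspace_filt]
lemmas filt_zero [simp] = fv.subspace_0[OF subspace_filt]
lemmas filt_sum = fv.subspace_sum[OF subspace_filt]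

lemma filt_gen: "int (sum_list is) \<le> m \<Longrightarrow> foldr (current z N Esl) is cyclic_vec \<in> filt z N m"
  unfolding filt_def by (rule fv.span_base) blast

lemma cyclic_in_filt: "0 \<le> m \<Longrightarrow> cyclic_vec \<in> filt z N m"
  using filt_gen[of "[]" m] by simp

lemma filt_induct [consumes 1, case_names gen zero add scale]:
  assumes "v \<in> filt z N m"
    and gen: "\<And>is. int (sum_list is) \<le> m \<Longrightarrow> P (foldr (current z N Esl) is cyclic_vec)"
    and zero: "P 0"
    and add: "\<And>u w. u \<in> filt z N m \<Longrightarrow> w \<in> filt z N m \<Longrightarrow> P u \<Longrightarrow> P w \<Longrightarrow> P (u + w)"
    and scale: "\<And>c u. u \<in> filt z N m \<Longrightarrow> P u \<Longrightarrow> P (fscale c u)"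
  shows "P v"
proof -
  have "fv.subspace {u \<in> filt z N m. P u}"
    by (rule fv.subspaceI) (auto intro: zero add scale filt_add filt_scale)
  moreover have "{foldr (current z N Esl) is cyclic_vec | is. int (sum_list is) \<le> m}
      \<subseteq> {u \<in> filt z N m. P u}"
    using gen filt_gen by blast
  ultimately have "filt z N m \<subseteq> {u \<in> filt z N m. P u}"
    by (subst (1) filt_def) (rule fv.span_minimal)
  then show ?thesis using assms(1) by blast
qed

lemma current_e_filt: "v \<in> filt z N m \<Longrightarrow> current z N Esl i v \<in> filt z N (m + int i)"
proof (induction rule: filt_induct)
  case (gen js)
  then show ?case using filt_gen[of "i # js" "m + int i"] by simp
qed (auto simp: current_linear intro: filt_add filt_scale)

text \<open>Moving \<open>h\<close> to the right through a monomial in the \<open>e\<close>'s only raises one index at a time, by the degree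
of \<open>h\<close>.\<close>

lemma current_h_filt: "v \<in> filt z N m \<Longrightarrow> current z N Hsl i v \<in> filt z N (m + int i)"
proof (induction rule: filt_induct)
  case (gen js)
  have "current z N Hsl i (foldr (current z N Esl) js cyclic_vec) \<in> filt z N (int (sum_list js) + int i)"
  proof (induction js)
    case Nil
    then show ?case unfolding foldr_Nil id_apply current_h_cyclic by (intro filt_scale cyclic_in_filt) simp
  next
    case (Cons j js)
    have "current z N Esl (i + j) (foldr (current z N Esl) js cyclic_vec)
        \<in> filt z N (int (sum_list js) + int (i + j))"
      by (intro current_e_filt filt_gen) simp
    moreover have "current z N Esl j (current z N Hsl i (foldr (current z N Esl) js cyclic_vec))
        \<in> filt z N (int (sum_list js) + int i + int j)"
      by (intro current_e_filt Cons)
    ultimately show ?case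
      by (auto simp: current_h_e algebra_simps intro!: filt_add filt_scale)
  qed
  then show ?case using filt_mono[of "int (sum_list js) + int i" "m + int i"] gen by auto
qed (auto simp: current_linear intro: filt_add filt_scale)

text \<open>In degree at least \<open>N\<close> the current is a combination of those of smaller degree, because on the
\<open>N\<close> evaluation points a power \<open>z\<^sup>i\<close> with \<open>i \<ge> N\<close> agrees with a polynomial of degree less than \<open>i\<close>. So
its class in the associated graded space is zero.\<close>

lemma current_e_filt_drop:
  assumes "v \<in> filt z N m" "N \<le> i"
  shows "current z N Esl i v \<in> filt z N (m + int i - 1)"
proof -
  obtain c where c: "\<And>s. s < N \<Longrightarrow> z s ^ i = (\<Sum>k<i. c k * z s ^ k)"
    using power_reduction[OF assms(2)] by blast
  have "current z N Esl i v = (\<Sum>s<N. fscale (\<Sum>k<i. c k * z s ^ k) (site Esl s v))"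
    by (simp add: current_eq_site c)
  also have "\<dots> = (\<Sum>s<N. \<Sum>k<i. fscale (c k) (fscale (z s ^ k) (site Esl s v)))"
    by (simp add: fv.scale_sum_left)
  also have "\<dots> = (\<Sum>k<i. fscale (c k) (current z N Esl k v))"
    by (subst sum.swap) (simp add: current_eq_site fv.scale_sum_right)
  also have "\<dots> \<in> filt z N (m + int i - 1)"
  proof (intro filt_sum filt_scale)
    fix k assume "k \<in> {..<i}"
    then show "current z N Esl k v \<in> filt z N (m + int i - 1)"
      using current_e_filt[OF assms(1), of k] filt_mono[of "m + int k" "m + int i - 1" z N] by auto
  qed
  finally show ?thesis .
qed

section \<open>The fusion product\<close>

lemma coset_eq:
  assumes W: "fv.subspace W" and vw: "v - w \<in> W"
  shows "(+) v ` W = (+) w ` W"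
proof -
  have sub: "(+) u ` W \<subseteq> (+) u' ` W" if "u - u' \<in> W" for u u'
  proof (rule image_subsetI)
    fix x assume "x \<in> W"
    have "u' + ((u - u') + x) = ((u - u') + u') + x" by (simp only: ac_simps)
    then have "u + x = u' + ((u - u') + x)" by (simp only: diff_add_cancel)
    moreover have "(u - u') + x \<in> W" by (rule fv.subspace_add[OF W that \<open>x \<in> W\<close>])
    ultimately show "u + x \<in> (+) u' ` W" by (rule image_eqI)
  qed
  have "- (v - w) \<in> W" by (rule fv.subspace_neg[OF W vw])
  then have "w - v \<in> W" by (simp only: minus_diff_eq)
  then show ?thesis by (intro equalityI sub vw)
qed

lemma coset_add:
  assumes "fv.subspace W"
  shows "{a + b | a b. a \<in> (+) v ` W \<and> b \<in> (+) w ` W} = (+) (v + w) ` W" (is "?L = _")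
proof (intro equalityI subsetI)
  fix x assume "x \<in> ?L"
  then obtain a b where "a \<in> W" "b \<in> W" "x = (v + a) + (w + b)" by blast
  then show "x \<in> (+) (v + w) ` W"
    using fv.subspace_add[OF assms, of a b]
    by (intro image_eqI[of _ _ "a + b"]) (simp_all add: ac_simps)
next
  fix x assume "x \<in> (+) (v + w) ` W"
  then obtain a where "a \<in> W" "x = (v + w) + a" by blast
  then have "a \<in> W" "x = (v + a) + (w + 0)" by (simp_all add: ac_simps)
  then show "x \<in> ?L" using fv.subspace_0[OF assms] by blast
qed

text \<open>The common form of the operations on classes: scaling and the action of a current are both defined on
cosets by such a set.\<close>

lemma coset_map:
  fixes F :: "'a::monoid_add \<Rightarrow> ('b \<Rightarrow>\<^sub>0 complex)"
  assumes "fv.subspace W" "\<And>u w. F (u + w) = F u + F w" "F ` W' \<subseteq> W" "0 \<in> W'"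
  shows "{F a + b | a b. a \<in> (+) v ` W' \<and> b \<in> W} = (+) (F v) ` W" (is "?L = _")
proof (intro equalityI subsetI)
  fix x assume "x \<in> ?L"
  then obtain a b where "a \<in> W'" "b \<in> W" "x = F (v + a) + b" by blast
  moreover have "F a + b \<in> W" using calculation assms(1,3) by (auto intro: fv.subspace_add)
  ultimately show "x \<in> (+) (F v) ` W"
    using assms(2) by (intro image_eqI[of _ _ "F a + b"]) (simp_all add: ac_simps)
next
  fix x assume "x \<in> (+) (F v) ` W"
  then obtain a where "a \<in> W" "x = F (v + 0) + a" by auto
  then show "x \<in> ?L" using assms(4) by blast
qed

definition fusion_zero :: "(nat \<Rightarrow> complex) \<Rightarrow> nat \<Rightarrow> fusion_vec" where
  "fusion_zero z N = (\<lambda>m. filt z N (int m - 1))"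

lemma fusion_class_zero: "v \<in> filt z N (int m - 1) \<Longrightarrow> fusion_class z N m v = fusion_zero z N"
  using coset_eq[OF subspace_filt, of v 0 z N "int m - 1"]
  by (auto simp: fusion_class_def fusion_zero_def fun_eq_iff)

lemma fusion_class_in: "v \<in> filt z N (int m) \<Longrightarrow> fusion_class z N m v \<in> fusion z N"
  unfolding fusion_def fusion_class_def
proof (intro CollectI conjI allI)
  fix l assume v: "v \<in> filt z N (int m)"
  show "\<exists>w\<in>filt z N (int l). (if l = m then (+) v ` filt z N (int m - 1) else filt z N (int l - 1))
      = (+) w ` filt z N (int l - 1)"
    using v by (cases "l = m") (auto intro: bexI[of _ v] bexI[of _ 0])
qed (auto intro: finite_subset[of _ "{m}"])

lemma fusion_compE:
  assumes "\<phi> \<in> fusion z N"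
  obtains v where "v \<in> filt z N (int m)" "\<phi> m = (+) v ` filt z N (int m - 1)"
  using assms unfolding fusion_def by blast

lemma fusion_add_in:
  assumes "\<phi> \<in> fusion z N" "\<psi> \<in> fusion z N"
  shows "fusion_add \<phi> \<psi> \<in> fusion z N"
  unfolding fusion_def
proof (intro CollectI conjI allI)
  fix m
  obtain v where v: "v \<in> filt z N (int m)" "\<phi> m = (+) v ` filt z N (int m - 1)"
    using fusion_compE[OF assms(1)] by blast
  obtain w where w: "w \<in> filt z N (int m)" "\<psi> m = (+) w ` filt z N (int m - 1)"
    using fusion_compE[OF assms(2)] by blast
  show "\<exists>v\<in>filt z N (int m). fusion_add \<phi> \<psi> m = (+) v ` filt z N (int m - 1)"
    unfolding fusion_add_def v w coset_add[OF subspace_filt]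
    using v w by (auto intro: filt_add)
next
  have "{m. fusion_add \<phi> \<psi> m \<noteq> filt z N (int m - 1)}
      \<subseteq> {m. \<phi> m \<noteq> filt z N (int m - 1)} \<union> {m. \<psi> m \<noteq> filt z N (int m - 1)}"
  proof clarify
    fix m assume *: "fusion_add \<phi> \<psi> m \<noteq> filt z N (int m - 1)" "\<psi> m = filt z N (int m - 1)"
      "\<phi> m = filt z N (int m - 1)"
    then show False
      using coset_add[OF subspace_filt, of 0 z N "int m - 1" 0] by (simp add: fusion_add_def)
  qed
  then show "finite {m. fusion_add \<phi> \<psi> m \<noteq> filt z N (int m - 1)}"
    by (rule finite_subset) (use assms in \<open>auto simp: fusion_def\<close>)
qed

lemma coset_scale: "{fscale c a + b | a b. a \<in> (+) v ` filt z N m \<and> b \<in> filt z N m}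
    = (+) (fscale c v) ` filt z N m"
  by (rule coset_map) (auto simp: subspace_filt fv.scale_right_distrib intro: filt_scale)

lemma fusion_scale_in:
  assumes "\<phi> \<in> fusion z N"
  shows "fusion_scale z N c \<phi> \<in> fusion z N"
  unfolding fusion_def
proof (intro CollectI conjI allI)
  fix m
  obtain v where v: "v \<in> filt z N (int m)" "\<phi> m = (+) v ` filt z N (int m - 1)"
    using fusion_compE[OF assms(1)] by blast
  show "\<exists>v\<in>filt z N (int m). fusion_scale z N c \<phi> m = (+) v ` filt z N (int m - 1)"
    unfolding fusion_scale_def v coset_scale using v by (auto intro: filt_scale)
next
  have "{m. fusion_scale z N c \<phi> m \<noteq> filt z N (int m - 1)} \<subseteq> {m. \<phi> m \<noteq> filt z N (int m - 1)}"
  proof clarify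
    fix m assume *: "fusion_scale z N c \<phi> m \<noteq> filt z N (int m - 1)"
      "\<phi> m = filt z N (int m - 1)"
    then show False using coset_scale[of c 0 z N "int m - 1"] by (simp add: fusion_scale_def)
  qed
  then show "finite {m. fusion_scale z N c \<phi> m \<noteq> filt z N (int m - 1)}"
    by (rule finite_subset) (use assms in \<open>auto simp: fusion_def\<close>)
qed

lemma fusion_class_add: "fusion_add (fusion_class z N m v) (fusion_class z N m w) = fusion_class z N m (v + w)"
proof
  fix l
  show "fusion_add (fusion_class z N m v) (fusion_class z N m w) l = fusion_class z N m (v + w) l"
    using coset_add[OF subspace_filt, of v z N "int m - 1" w] coset_add[OF subspace_filt, of 0 z N "int l - 1" 0]
    by (simp add: fusion_add_def fusion_class_def)
qed

lemma fusion_class_scale: "fusion_scale z N c (fusion_class z N m v) = fusion_class z N m (fscale c v)"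
proof
  fix l
  show "fusion_scale z N c (fusion_class z N m v) l = fusion_class z N m (fscale c v) l"
    using coset_scale[of c v z N "int m - 1"] coset_scale[of c 0 z N "int l - 1"]
    by (simp add: fusion_scale_def fusion_class_def)
qed

text \<open>The case distinction in the proof is over the components: the action moves component \<open>m\<close> to
\<open>m + i\<close>, and every component that does not come from \<open>m\<close> stays zero.\<close>

lemma fusion_act_class:
  assumes stable: "\<And>m w. w \<in> filt z N m \<Longrightarrow> current z N x i w \<in> filt z N (m + int i)"
  shows "fusion_act z N x i (fusion_class z N m v) = fusion_class z N (m + i) (current z N x i v)"
proof
  fix l
  have *: "{current z N x i a + b | a b. a \<in> (+) w ` filt z N (int (l - i) - 1) \<and> b \<in> filt z N (int l - 1)}
      = (+) (current z N x i w) ` filt z N (int l - 1)" if "i \<le> l" for w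
  proof (rule coset_map)
    show "current z N x i ` filt z N (int (l - i) - 1) \<subseteq> filt z N (int l - 1)"
      using stable[of _ "int (l - i) - 1"] that by (auto simp: algebra_simps of_nat_diff)
  qed (auto simp: subspace_filt current_linear)
  show "fusion_act z N x i (fusion_class z N m v) l = fusion_class z N (m + i) (current z N x i v) l"
  proof (cases "i \<le> l")
    case True
    show ?thesis
    proof (cases "l = m + i")
      case True
      then show ?thesis using *[of v] by (simp add: fusion_act_def fusion_class_def)
    next
      case False
      then have "l - i \<noteq> m" using True by auto
      then show ?thesis using *[of 0] True False
        by (simp add: fusion_act_def fusion_class_def current_linear)
    qed
  next
    case False
    then show ?thesis by (simp add: fusion_act_def fusion_class_def)
  qed
qed

text \<open>Each element is the finite sum of its homogeneous components; the proof removes one component after the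
other.\<close>

lemma fusion_induct [consumes 1, case_names homogeneous add]:
  assumes "\<phi> \<in> fusion z N"
    and cls: "\<And>m v. v \<in> filt z N (int m) \<Longrightarrow> P (fusion_class z N m v)"
    and add: "\<And>\<phi> \<psi>. \<phi> \<in> fusion z N \<Longrightarrow> \<psi> \<in> fusion z N \<Longrightarrow> P \<phi> \<Longrightarrow> P \<psi> \<Longrightarrow> P (fusion_add \<phi> \<psi>)"
  shows "P \<phi>"
proof -
  define supp where "supp \<phi> = {m. \<phi> m \<noteq> filt z N (int m - 1)}" for \<phi> :: fusion_vec
  have "finite (supp \<phi>)" using assms(1) by (simp add: fusion_def supp_def)
  then show ?thesis using assms(1)
  proof (induction "supp \<phi>" arbitrary: \<phi> rule: finite_psubset_induct)
    case (psubset \<phi>)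
    show ?case
    proof (cases "supp \<phi> = {}")
      case True
      then have "\<phi> = fusion_zero z N" by (auto simp: supp_def fusion_zero_def)
      then show ?thesis using cls[of 0 0] fusion_class_zero[of 0 z N 0] by simp
    next
      case False
      then obtain m where m: "m \<in> supp \<phi>" by blast
      obtain v where v: "v \<in> filt z N (int m)" "\<phi> m = (+) v ` filt z N (int m - 1)"
        using fusion_compE[OF psubset.prems] by blast
      define \<psi> where "\<psi> = \<phi>(m := filt z N (int m - 1))"
      have supp: "supp \<psi> = supp \<phi> - {m}" by (auto simp: supp_def \<psi>_def)
      have \<psi>: "\<psi> \<in> fusion z N"
        unfolding fusion_def
      proof (intro CollectI conjI allI)
        fix l
        show "\<exists>v\<in>filt z N (int l). \<psi> l = (+) v ` filt z N (int l - 1)"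
          by (rule fusion_compE[OF psubset.prems, of l])
            (cases "l = m"; auto simp: \<psi>_def intro: bexI[of _ 0])
      next
        show "finite {m. \<psi> m \<noteq> filt z N (int m - 1)}"
          using supp psubset.hyps(1) by (simp add: supp_def)
      qed
      have "\<phi> = fusion_add (fusion_class z N m v) \<psi>"
      proof
        fix l
        obtain w where w: "\<phi> l = (+) w ` filt z N (int l - 1)"
          using fusion_compE[OF psubset.prems] by blast
        show "\<phi> l = fusion_add (fusion_class z N m v) \<psi> l"
          using coset_add[OF subspace_filt, of 0 z N "int l - 1" w]
            coset_add[OF subspace_filt, of v z N "int m - 1" 0] w v
          by (auto simp: fusion_add_def fusion_class_def \<psi>_def)
      qed
      moreover have "P \<psi>" by (rule psubset.hyps(2)) (use supp m \<psi> in auto)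
      ultimately show ?thesis using add fusion_class_in[OF v(1)] \<psi> cls[OF v(1)] by metis
    qed
  qed
qed

section \<open>Two-row tableaux\<close>

lemma cells_subtableau: "cells (subtableau \<tau> l) = {(r, c). \<tau> r c \<noteq> 0 \<and> \<tau> r c \<le> l}"
  by (auto simp: cells_def subtableau_def)

lemma has_shape_iff:
  assumes "has_shape \<tau> a b"
  shows "\<tau> r c \<noteq> 0 \<longleftrightarrow> (r = 0 \<and> c < a) \<or> (r = 1 \<and> c < b)"
proof -
  have "\<tau> r c \<noteq> 0 \<longleftrightarrow> (r, c) \<in> cells \<tau>" by (simp add: cells_def)
  then show ?thesis using assms by (auto simp: has_shape_def)
qed

lemma row_length_shape:
  assumes "has_shape \<tau> a b"
  shows "row_length \<tau> 0 = a" "row_length \<tau> (Suc 0) = b"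
proof -
  have "{c. \<tau> 0 c \<noteq> 0} = {..<a}" "{c. \<tau> (Suc 0) c \<noteq> 0} = {..<b}"
    using has_shape_iff[OF assms] by auto
  then show "row_length \<tau> 0 = a" "row_length \<tau> (Suc 0) = b" by (simp_all add: row_length_def)
qed

lemma SYT_entry_le: "\<tau> \<in> SYT a b \<Longrightarrow> \<tau> r c \<le> a + b"
proof -
  assume t: "\<tau> \<in> SYT a b"
  show "\<tau> r c \<le> a + b"
  proof (cases "\<tau> r c = 0")
    case False
    then have "(r, c) \<in> cells \<tau>" by (simp add: cells_def)
    moreover have "(\<lambda>(r, c). \<tau> r c) ` cells \<tau> = {1..a + b}"
      using t by (auto simp: SYT_def bij_betw_def)
    ultimately show ?thesis by force
  qed simp
qed

text \<open>Truncation is a left inverse of infinite continuation, which makes the maps \<open>X_to_limit\<close> injective.\<close>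

lemma subtableau_add_inf:
  assumes t: "\<tau> \<in> SYT a b" and N: "N = a + b"
  shows "subtableau (add_inf N \<tau>) N = \<tau>"
proof (intro ext)
  fix r c
  have sh: "has_shape \<tau> a b" using t by (simp add: SYT_def)
  show "subtableau (add_inf N \<tau>) N r c = \<tau> r c"
  proof (cases "r < 2 \<and> row_length \<tau> r \<le> c")
    case True
    then have "r = 0 \<and> a \<le> c \<or> r = 1 \<and> b \<le> c"
      using row_length_shape[OF sh] by (cases r) (auto simp: less_2_cases_iff)
    then have "\<tau> r c = 0" using has_shape_iff[OF sh, of r c] by auto
    then show ?thesis using True by (simp add: subtableau_def add_inf_def)
  next
    case False
    then show ?thesis using SYT_entry_le[OF t, of r c] N by (auto simp: subtableau_def add_inf_def)
  qed
qed

lemma tau_in_row: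
  "in_row (tau k) 0 i \<Longrightarrow> i > 2 * k + 1 \<Longrightarrow> odd i"
  "in_row (tau k) (Suc 0) i \<Longrightarrow> even i"
  by (auto simp: in_row_def tau_def split: if_splits)

text \<open>The shapes of the truncations bracket the entry in each cell between two consecutive even numbers, and
tail equivalence to \<open>tau k\<close> decides by parity which of the two remaining values it takes.\<close>

lemma tail_entries:
  assumes t: "\<tau> \<in> tail_tableaux k"
  obtains n0 where "n0 \<ge> k"
    "\<And>n. n \<ge> n0 \<Longrightarrow> has_shape (subtableau \<tau> (2 * n)) (n + k) (n - k)"
    "\<And>n a. n \<ge> n0 \<Longrightarrow> \<tau> 0 (n + k + a) = 2 * (n + a) + 1"
    "\<And>n a. n \<ge> n0 \<Longrightarrow> \<tau> 1 (n - k + a) = 2 * (n + a) + 2"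
proof -
  note t' = t[unfolded tail_tableaux_def, simplified mem_Collect_eq]
  obtain n1 where n1: "n1 \<ge> k" "\<And>n. n \<ge> n1 \<Longrightarrow> has_shape (subtableau \<tau> (2 * n)) (n + k) (n - k)"
    using t' by blast
  have fin: "finite {i. \<exists>r. in_row \<tau> r i \<noteq> in_row (tau k) r i}" using t' by blast
  have cells: "cells \<tau> = {0, 1} \<times> UNIV" using t' by (simp add: infinite_SYT_def)
  obtain I where bd: "\<forall>i\<in>{i. \<exists>r. in_row \<tau> r i \<noteq> in_row (tau k) r i}. i \<le> I"
    using fin[unfolded finite_nat_set_iff_bounded_le] by (rule exE)
  have I: "in_row \<tau> r i = in_row (tau k) r i" if "i > I" for i r
  proof (rule ccontr)
    assume "in_row \<tau> r i \<noteq> in_row (tau k) r i"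
    then have "i \<in> {i. \<exists>r. in_row \<tau> r i \<noteq> in_row (tau k) r i}" by (intro CollectI exI)
    then have "i \<le> I" by (rule bspec[OF bd])
    then show False using that by simp
  qed
  define n0 where "n0 = max n1 (max I (k + 1))"
  have pos: "\<tau> r c \<noteq> 0" if "r \<in> {0, 1}" for r c
  proof -
    have "(r, c) \<in> cells \<tau>" using that cells by simp
    then show ?thesis by (simp add: cells_def)
  qed
  have row0: "\<tau> 0 c \<le> 2 * n \<longleftrightarrow> c < n + k" if "n \<ge> n0" for n c
    using has_shape_iff[OF n1(2)[of n], of 0 c] that pos[of 0 c]
    by (auto simp: subtableau_def n0_def split: if_splits)
  have row1: "\<tau> 1 c \<le> 2 * n \<longleftrightarrow> c < n - k" if "n \<ge> n0" for n c
    using has_shape_iff[OF n1(2)[of n], of 1 c] that pos[of 1 c]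
    by (auto simp: subtableau_def n0_def split: if_splits)
  have parity: "2 * m < x \<Longrightarrow> x \<le> 2 * (m + 1) \<Longrightarrow> odd x \<Longrightarrow> x = 2 * m + 1"
    "2 * m < x \<Longrightarrow> x \<le> 2 * (m + 1) \<Longrightarrow> even x \<Longrightarrow> x = 2 * m + 2" for m x :: nat
    by presburger+
  show ?thesis
  proof (rule that)
    show "n0 \<ge> k" using n1(1) by (simp add: n0_def)
    show "has_shape (subtableau \<tau> (2 * n)) (n + k) (n - k)" if "n \<ge> n0" for n
      using n1(2) that by (simp add: n0_def)
    fix n a assume n: "n \<ge> n0"
    have kn: "k \<le> n" "n \<ge> I" "n \<ge> k + 1" using n by (auto simp: n0_def)
    have lo: "2 * (n + a) < \<tau> 0 (n + k + a)" and hi: "\<tau> 0 (n + k + a) \<le> 2 * (n + a + 1)"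
      using row0[of "n + a" "n + k + a"] row0[of "n + a + 1" "n + k + a"] n by auto
    have n2: "I \<le> 2 * (n + a)" "2 * k + 1 \<le> 2 * (n + a)" using kn by simp_all
    note gt = le_less_trans[OF n2(1) lo] and gt' = le_less_trans[OF n2(2) lo]
    have "in_row (tau k) 0 (\<tau> 0 (n + k + a))"
      unfolding I[symmetric, OF gt] by (auto simp: in_row_def)
    then show "\<tau> 0 (n + k + a) = 2 * (n + a) + 1"
      using parity(1)[OF lo hi] tau_in_row(1) gt' by blast
    have lo: "2 * (n + a) < \<tau> 1 (n - k + a)" and hi: "\<tau> 1 (n - k + a) \<le> 2 * (n + a + 1)"
      using row1[of "n + a" "n - k + a"] row1[of "n + a + 1" "n - k + a"] n kn by auto
    note gt = le_less_trans[OF n2(1) lo]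
    have "in_row (tau k) (Suc 0) (\<tau> 1 (n - k + a))"
      unfolding I[symmetric, OF gt] by (auto simp: in_row_def)
    then show "\<tau> 1 (n - k + a) = 2 * (n + a) + 2"
      using parity(2)[OF lo hi] tau_in_row(2) by blast
  qed
qed

lemma infinite_SYT_inj:
  assumes "\<tau> \<in> infinite_SYT" "\<tau> r c = \<tau> r' c'" "\<tau> r c \<noteq> 0"
  shows "r = r' \<and> c = c'"
proof -
  have "inj_on (\<lambda>(r, c). \<tau> r c) (cells \<tau>)" using assms(1) by (auto simp: infinite_SYT_def bij_betw_def)
  from inj_onD[OF this, of "(r, c)" "(r', c')"] assms show ?thesis by (auto simp: cells_def)
qed

lemma subtableau_SYT:
  assumes t: "\<tau> \<in> infinite_SYT" and sh: "has_shape (subtableau \<tau> (a + b)) a b"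
  shows "subtableau \<tau> (a + b) \<in> SYT a b"
proof -
  let ?s = "subtableau \<tau> (a + b)"
  have inc: "increasing_tableau \<tau>" and bij: "bij_betw (\<lambda>(r, c). \<tau> r c) (cells \<tau>) {1..}"
    using t unfolding infinite_SYT_def by blast+
  note inc1 = inc[unfolded increasing_tableau_def, THEN conjunct1, rule_format]
  note inc2 = inc[unfolded increasing_tableau_def, THEN conjunct2, rule_format]
  have s: "?s r c = (if \<tau> r c \<le> a + b then \<tau> r c else 0)" for r c
    by (simp add: subtableau_def)
  have "increasing_tableau ?s"
    unfolding increasing_tableau_def
  proof (intro conjI allI impI)
    fix r c assume "?s r (c + 1) \<noteq> 0"
    then have "\<tau> r (c + 1) \<noteq> 0" "\<tau> r (c + 1) \<le> a + b" unfolding s by presburger+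
    then show "?s r c < ?s r (c + 1)" using inc1[of r c] unfolding s by presburger
  next
    fix r c assume "?s (r + 1) c \<noteq> 0"
    then have "\<tau> (r + 1) c \<noteq> 0" "\<tau> (r + 1) c \<le> a + b" unfolding s by presburger+
    then show "?s r c < ?s (r + 1) c" using inc2[of r c] unfolding s by presburger
  qed
  moreover have "bij_betw (\<lambda>(r, c). ?s r c) (cells ?s) {1..a + b}"
    unfolding bij_betw_def
  proof
    show "inj_on (\<lambda>(r, c). ?s r c) (cells ?s)"
    proof (rule inj_onI)
      fix p q assume "p \<in> cells ?s" "q \<in> cells ?s" and
        eq: "(case p of (r, c) \<Rightarrow> ?s r c) = (case q of (r, c) \<Rightarrow> ?s r c)"
      then have "\<tau> (fst p) (snd p) \<noteq> 0" "\<tau> (fst p) (snd p) = \<tau> (fst q) (snd q)"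
        unfolding cells_subtableau by (simp_all add: s case_prod_beta)
      then show "p = q" using infinite_SYT_inj[OF t] by (metis prod.collapse)
    qed
    have im: "(\<lambda>(r, c). \<tau> r c) ` cells \<tau> = {1..}" using bij by (simp add: bij_betw_def)
    show "(\<lambda>(r, c). ?s r c) ` cells ?s = {1..a + b}"
    proof (intro equalityI subsetI)
      fix x assume "x \<in> (\<lambda>(r, c). ?s r c) ` cells ?s"
      then obtain r c where "\<tau> r c \<noteq> 0" "\<tau> r c \<le> a + b" "x = ?s r c"
        unfolding cells_subtableau by auto
      then show "x \<in> {1..a + b}" by (simp add: s)
    next
      fix x assume x: "x \<in> {1..a + b}"
      then have "x \<in> (\<lambda>(r, c). \<tau> r c) ` cells \<tau>" using im by auto
      then obtain r c where "x = \<tau> r c" by auto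
      then show "x \<in> (\<lambda>(r, c). ?s r c) ` cells ?s"
        unfolding cells_subtableau using x by (intro image_eqI[of _ _ "(r, c)"]) (simp_all add: s)
    qed
  qed
  ultimately show ?thesis using sh by (simp add: SYT_def)
qed

text \<open>Passing from \<open>2n\<close> to \<open>2n + 2\<close> entries adds the descent \<open>2n + 1\<close>. The number \<open>2n\<close> does not become
a descent, as \<open>2n + 1\<close> lies in the first row.\<close>

lemma maj_subtableau_Suc:
  assumes t: "\<tau> \<in> infinite_SYT" and odd: "\<tau> 0 c0 = 2 * n + 1" and even: "\<tau> 1 c1 = 2 * n + 2"
  shows "maj (subtableau \<tau> (2 * (n + 1))) = maj (subtableau \<tau> (2 * n)) + (2 * n + 1)"
proof -
  define D where "D l = {i. 1 \<le> i \<and> i + 1 \<le> l \<and> (\<exists>r r'. r < r' \<and> in_row \<tau> r i \<and> in_row \<tau> r' (i + 1))}" for l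
  have maj: "maj (subtableau \<tau> l) = \<Sum> (D l)" for l
  proof -
    have row: "in_row (subtableau \<tau> l) r i \<longleftrightarrow> in_row \<tau> r i \<and> i \<le> l" if "i \<ge> 1" for r i
      using that by (auto simp: in_row_def subtableau_def split: if_splits)
    then have "{i. 1 \<le> i \<and> (\<exists>r r'. r < r' \<and> in_row (subtableau \<tau> l) r i \<and> in_row (subtableau \<tau> l) r' (i + 1))} = D l"
      unfolding D_def
    proof (intro Collect_cong)
      fix i
      show "(1 \<le> i \<and> (\<exists>r r'. r < r' \<and> in_row (subtableau \<tau> l) r i \<and> in_row (subtableau \<tau> l) r' (i + 1)))
        \<longleftrightarrow> (1 \<le> i \<and> i + 1 \<le> l \<and> (\<exists>r r'. r < r' \<and> in_row \<tau> r i \<and> in_row \<tau> r' (i + 1)))"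
      proof (cases "1 \<le> i")
        case True
        have "in_row (subtableau \<tau> l) r i \<longleftrightarrow> in_row \<tau> r i \<and> i \<le> l"
          "in_row (subtableau \<tau> l) r (i + 1) \<longleftrightarrow> in_row \<tau> r (i + 1) \<and> i + 1 \<le> l" for r
          using True by (intro row; simp)+
        moreover have "i + 1 \<le> l \<Longrightarrow> i \<le> l" by simp
        ultimately show ?thesis by blast
      qed simp
    qed
    then show ?thesis by (simp add: maj_def)
  qed
  have fin: "finite (D l)" for l by (rule finite_subset[of _ "{..l}"]) (auto simp: D_def)
  have row: "in_row \<tau> r i \<longleftrightarrow> r = r0" if "\<tau> r0 c = i" "i \<noteq> 0" for r r0 c i
  proof
    assume "in_row \<tau> r i"
    then obtain c' where "\<tau> r c' = i" by (auto simp: in_row_def)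
    then show "r = r0" using infinite_SYT_inj[OF t, of r c' r0 c] that by simp
  qed (use that in \<open>auto simp: in_row_def\<close>)
  have row_odd: "in_row \<tau> r (2 * n + 1) \<longleftrightarrow> r = 0" for r
    by (rule row[OF odd]) simp
  have row_even: "in_row \<tau> r (2 * n + 2) \<longleftrightarrow> r = 1" for r
    by (rule row[OF even]) simp
  have "D (2 * (n + 1)) = insert (2 * n + 1) (D (2 * n))"
  proof (intro equalityI subsetI)
    fix i assume i: "i \<in> D (2 * (n + 1))"
    then have "i + 1 \<le> 2 * (n + 1)" by (simp add: D_def)
    then have "i + 1 \<le> 2 * n \<or> i = 2 * n \<or> i = 2 * n + 1" by presburger
    then consider "i + 1 \<le> 2 * n" | "i = 2 * n" | "i = 2 * n + 1" by blast
    then show "i \<in> insert (2 * n + 1) (D (2 * n))"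
    proof cases
      case 2
      then obtain r r' :: nat where "r < r'" "in_row \<tau> r' (2 * n + 1)" using i by (auto simp: D_def)
      then show ?thesis by (simp only: row_odd)
    qed (use i in \<open>simp_all add: D_def\<close>)
  next
    fix i assume "i \<in> insert (2 * n + 1) (D (2 * n))"
    then show "i \<in> D (2 * (n + 1))"
    proof
      assume "i = 2 * n + 1"
      moreover have "in_row \<tau> 0 (2 * n + 1)" "in_row \<tau> 1 (2 * n + 1 + 1)"
        using row_odd[of 0] row_even[of 1] by simp_all
      ultimately show ?thesis
        unfolding D_def by (intro CollectI conjI exI[of _ 0] exI[of _ 1]) simp_all
    qed (simp add: D_def)
  qed
  moreover have "2 * n + 1 \<notin> D (2 * n)" by (simp add: D_def)
  ultimately show ?thesis by (simp add: maj fin)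
qed

text \<open>Far out, a tableau in \<open>\<T>\<^sub>k\<close> is the periodic continuation of its truncation, so the image of a
truncation in the limit space is the tableau itself, and \<open>n\<^sup>2 - maj\<close> has reached its limit.\<close>

lemma tail_tableau_stabilises:
  assumes t: "\<tau> \<in> tail_tableaux k"
  obtains n0 where "n0 \<ge> k"
    "\<And>n. n \<ge> n0 \<Longrightarrow> subtableau \<tau> (2 * n) \<in> SYT (n + k) (n - k)"
    "\<And>n. n \<ge> n0 \<Longrightarrow> add_inf (2 * n) (subtableau \<tau> (2 * n)) = \<tau>"
    "\<And>n. n \<ge> n0 \<Longrightarrow> (real n)\<^sup>2 - real (maj (subtableau \<tau> (2 * n))) = stable_maj \<tau>"
proof -
  obtain n0 where n0: "n0 \<ge> k"
    and sh: "\<And>n. n \<ge> n0 \<Longrightarrow> has_shape (subtableau \<tau> (2 * n)) (n + k) (n - k)"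
    and row0: "\<And>n a. n \<ge> n0 \<Longrightarrow> \<tau> 0 (n + k + a) = 2 * (n + a) + 1"
    and row1: "\<And>n a. n \<ge> n0 \<Longrightarrow> \<tau> 1 (n - k + a) = 2 * (n + a) + 2"
    using tail_entries[OF t] by metis
  have inf: "\<tau> \<in> infinite_SYT" using t by (simp add: tail_tableaux_def)
  have cells: "cells \<tau> = {0, 1} \<times> UNIV" using inf by (simp add: infinite_SYT_def)
  have syt: "subtableau \<tau> (2 * n) \<in> SYT (n + k) (n - k)" if "n \<ge> n0" for n
  proof -
    have "n + k + (n - k) = 2 * n" using that n0 by simp
    from subtableau_SYT[OF inf, of "n + k" "n - k", unfolded this, OF sh[OF that]] show ?thesis .
  qed
  have add: "add_inf (2 * n) (subtableau \<tau> (2 * n)) = \<tau>" if n: "n \<ge> n0" for n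
  proof (intro ext)
    fix r c :: nat
    let ?s = "subtableau \<tau> (2 * n)"
    have s: "?s r c \<noteq> 0 \<Longrightarrow> ?s r c = \<tau> r c" by (simp add: subtableau_def split: if_splits)
    note rl = row_length_shape[OF sh[OF n]]
    note nz = has_shape_iff[OF sh[OF n], of r c]
    have "r \<ge> 2 \<or> r = 0 \<or> r = 1" by presburger
    then consider "r \<ge> 2" | "r = 0" | "r = 1" by blast
    then show "add_inf (2 * n) ?s r c = \<tau> r c"
    proof cases
      case 1
      then have "(r, c) \<notin> cells \<tau>" unfolding cells by simp
      then have "\<tau> r c = 0" by (simp add: cells_def)
      then show ?thesis using 1 by (simp add: add_inf_def subtableau_def)
    next
      case 2
      show ?thesis
      proof (cases "n + k \<le> c")
        case True
        then obtain a where c: "c = n + k + a" using le_Suc_ex by blast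
        show ?thesis unfolding add_inf_def 2 c row0[OF n] by (simp add: rl)
      next
        case False
        then have "?s r c \<noteq> 0" using nz 2 by simp
        moreover have "add_inf (2 * n) ?s r c = ?s r c"
          unfolding add_inf_def 2 using False by (simp add: rl)
        ultimately show ?thesis using s by metis
      qed
    next
      case 3
      show ?thesis
      proof (cases "n - k \<le> c")
        case True
        then obtain a where c: "c = n - k + a" using le_Suc_ex by blast
        show ?thesis unfolding add_inf_def 3 c row1[OF n] by (simp add: rl)
      next
        case False
        then have "?s r c \<noteq> 0" using nz 3 by simp
        moreover have "add_inf (2 * n) ?s r c = ?s r c"
          unfolding add_inf_def 3 using False by (simp add: rl)
        ultimately show ?thesis using s by metis
      qed
    qed
  qed
  let ?d = "\<lambda>n. (real n)\<^sup>2 - real (maj (subtableau \<tau> (2 * n)))"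
  have const: "?d n = ?d n0" if "n \<ge> n0" for n
    using that
  proof (induction n rule: dec_induct)
    case (step n)
    have "maj (subtableau \<tau> (2 * (n + 1))) = maj (subtableau \<tau> (2 * n)) + (2 * n + 1)"
      using maj_subtableau_Suc[OF inf, of "n + k" n "n - k"] row0[of n 0] row1[of n 0] step by simp
    then show ?case using step by (simp add: power2_eq_square algebra_simps)
  qed simp
  have "?d \<longlonglongrightarrow> ?d n0"
    by (rule tendsto_eventually, rule eventually_sequentiallyI[of n0], rule const)
  then have stab: "stable_maj \<tau> = ?d n0" unfolding stable_maj_def by (rule limI)
  have "?d n = stable_maj \<tau>" if "n \<ge> n0" for n using const[OF that] stab by (rule trans[OF _ sym])
  then show ?thesis using that[of n0] n0 syt add by blast
qed

section \<open>The limit of the fusion products\<close>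

locale fusion_limit = unitary_level_one sc act ip
  for sc :: "complex \<Rightarrow> 'v::ab_group_add \<Rightarrow> 'v"
    and act :: "sl2 \<Rightarrow> int \<Rightarrow> 'v \<Rightarrow> 'v"
    and ip :: "'v \<Rightarrow> 'v \<Rightarrow> complex" +
  fixes z :: "nat \<Rightarrow> nat \<Rightarrow> complex"
    and j :: "nat \<Rightarrow> fusion_vec \<Rightarrow> fusion_vec"
    and \<iota> :: "nat \<Rightarrow> fusion_vec \<Rightarrow> 'v"
    and R :: "nat \<Rightarrow> fusion_vec \<Rightarrow> tab_space"
    and \<rho> :: "'v \<Rightarrow> tab_space"
  assumes embeddings: "\<And>N. even N \<Longrightarrow> fusion_embedding z N (j N)"
    and limit: "is_fusion_limit z j sc \<iota>"
    and action_extends: "\<And>N x i \<phi>. even N \<Longrightarrow> \<phi> \<in> fusion (z N) N \<Longrightarrow>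
          \<iota> N (fusion_act (z N) N x i \<phi>) = act x (- int i) (\<iota> N \<phi>)"
    and isos: "\<And>N. even N \<Longrightarrow> graded_unitary_iso (z N) N (\<iota> N) ip (R N)"
    and limit_iso: "\<And>N \<phi>. even N \<Longrightarrow> \<phi> \<in> fusion (z N) N \<Longrightarrow>
          \<rho> (\<iota> N \<phi>) = X_to_limit N (R N \<phi>)"
begin

lemmas level_maps = limit[unfolded is_fusion_limit_def fusion_linear_def,
    THEN conjunct2, THEN conjunct1, THEN spec, THEN mp]

lemma iota_add: "even N \<Longrightarrow> \<phi> \<in> fusion (z N) N \<Longrightarrow> \<psi> \<in> fusion (z N) N \<Longrightarrow>
    \<iota> N (fusion_add \<phi> \<psi>) = \<iota> N \<phi> + \<iota> N \<psi>"
  by (rule level_maps[THEN conjunct1, THEN conjunct1, THEN bspec, THEN bspec])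

lemma iota_scale: "even N \<Longrightarrow> \<phi> \<in> fusion (z N) N \<Longrightarrow> \<iota> N (fusion_scale (z N) N c \<phi>) = sc c (\<iota> N \<phi>)"
  by (rule level_maps[THEN conjunct1, THEN conjunct2, THEN spec, THEN bspec])

lemma iota_step: "even N \<Longrightarrow> \<phi> \<in> fusion (z N) N \<Longrightarrow> \<iota> (N + 2) (j N \<phi>) = \<iota> N \<phi>"
  by (rule level_maps[THEN conjunct2, THEN conjunct2, THEN bspec])

text \<open>The system of embeddings makes the images of the levels an increasing family, so that finitely many
vectors of the limit lie in a common level.\<close>

lemma iota_lift:
  assumes "even N" "\<phi> \<in> fusion (z N) N"
  shows "\<exists>\<psi>\<in>fusion (z (N + 2 * d)) (N + 2 * d). \<iota> (N + 2 * d) \<psi> = \<iota> N \<phi>"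
proof (induction d)
  case 0
  then show ?case using assms by auto
next
  case (Suc d)
  let ?M = "N + 2 * d"
  obtain \<psi> where \<psi>: "\<psi> \<in> fusion (z ?M) ?M" "\<iota> ?M \<psi> = \<iota> N \<phi>" using Suc by blast
  have ev: "even ?M" using assms by simp
  have "j ?M \<psi> \<in> fusion (z (?M + 2)) (?M + 2)"
    using embeddings[OF ev] \<psi>(1) unfolding fusion_embedding_def by blast
  moreover have "\<iota> (?M + 2) (j ?M \<psi>) = \<iota> N \<phi>" using iota_step[OF ev \<psi>(1)] \<psi>(2) by simp
  moreover have "N + 2 * Suc d = ?M + 2" by simp
  ultimately show ?case by metis
qed

lemma iota_covers:
  obtains N \<phi> where "even N" "\<phi> \<in> fusion (z N) N" "v = \<iota> N \<phi>"
proof -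
  have "(\<Union>N\<in>{N. even N}. \<iota> N ` fusion (z N) N) = UNIV"
    using limit[unfolded is_fusion_limit_def, THEN conjunct2, THEN conjunct2] .
  then have "v \<in> (\<Union>N\<in>{N. even N}. \<iota> N ` fusion (z N) N)" by simp
  then show ?thesis using that by blast
qed

lemma iota_covers_pair:
  obtains N \<phi> \<psi> where "even N" "\<phi> \<in> fusion (z N) N" "\<psi> \<in> fusion (z N) N" "v = \<iota> N \<phi>" "w = \<iota> N \<psi>"
proof -
  obtain N \<phi> where 1: "even N" "\<phi> \<in> fusion (z N) N" "v = \<iota> N \<phi>" by (rule iota_covers)
  obtain M \<psi> where 2: "even M" "\<psi> \<in> fusion (z M) M" "w = \<iota> M \<psi>" by (rule iota_covers)
  from 1(1) 2(1) have L: "N + 2 * (M div 2) = N + M" "M + 2 * (N div 2) = N + M" by auto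
  obtain \<phi>' where "\<phi>' \<in> fusion (z (N + M)) (N + M)" "\<iota> (N + M) \<phi>' = v"
    using iota_lift[OF 1(1,2), of "M div 2"] unfolding L 1(3) by blast
  moreover obtain \<psi>' where "\<psi>' \<in> fusion (z (N + M)) (N + M)" "\<iota> (N + M) \<psi>' = w"
    using iota_lift[OF 2(1,2), of "N div 2"] unfolding L 2(3) by blast
  moreover have "even (N + M)" using 1(1) 2(1) by simp
  ultimately show ?thesis using that[of "N + M" \<phi>' \<psi>'] by blast
qed

abbreviation cl :: "nat \<Rightarrow> nat \<Rightarrow> spin \<Rightarrow> 'v" where
  "cl N m v \<equiv> \<iota> N (fusion_class (z N) N m v)"

lemma cl_add:
  assumes "even N" "v \<in> filt (z N) N (int m)" "w \<in> filt (z N) N (int m)"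
  shows "cl N m (v + w) = cl N m v + cl N m w"
  using iota_add[OF assms(1) fusion_class_in[OF assms(2)] fusion_class_in[OF assms(3)]]
  by (simp add: fusion_class_add)

lemma cl_scale:
  assumes "even N" "v \<in> filt (z N) N (int m)"
  shows "cl N m (fscale c v) = sc c (cl N m v)"
  using iota_scale[OF assms(1) fusion_class_in[OF assms(2)]] by (simp add: fusion_class_scale)

lemma cl_zero:
  assumes "even N" "v \<in> filt (z N) N (int m - 1)"
  shows "cl N m v = 0"
proof -
  have "fusion_class (z N) N m v = fusion_class (z N) N m 0"
    by (simp add: fusion_class_zero assms(2))
  then show ?thesis using cl_scale[OF assms(1), of 0 m 0] by simp
qed

lemma e_cl:
  assumes "even N" "v \<in> filt (z N) N (int m)"
  shows "e (- int i) (cl N m v) = cl N (m + i) (current (z N) N Esl i v)"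
  unfolding action_extends[OF assms(1) fusion_class_in[OF assms(2)], symmetric]
  by (rule arg_cong[OF fusion_act_class[OF current_e_filt]])

lemma h_cl:
  assumes "even N" "v \<in> filt (z N) N (int m)"
  shows "h (- int i) (cl N m v) = cl N (m + i) (current (z N) N Hsl i v)"
  unfolding action_extends[OF assms(1) fusion_class_in[OF assms(2)], symmetric]
  by (rule arg_cong[OF fusion_act_class[OF current_h_filt]])

text \<open>The vectors \<open>e (-i) v\<^sub>N\<close> (for \<open>i \<ge> N\<close>) and \<open>h (-i) v\<^sub>N\<close> (for \<open>i > 0\<close>) vanish because they have representatives
in a smaller step of the filtration than their degree; for \<open>h\<close> the representative is a multiple of
the cyclic vector.\<close>

lemma lowest_weight_vector_extremal:
  assumes N: "even N"
  shows "is_extremal (int N) (cl N 0 cyclic_vec)"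
  unfolding is_extremal_def
proof (intro conjI allI impI)
  have cyc: "cyclic_vec \<in> filt (z N) N (int 0)" by (simp add: cyclic_in_filt)
  show "e (- i) (cl N 0 cyclic_vec) = 0" if "i \<ge> int N" for i
  proof -
    have i: "i = int (nat i)" "N \<le> nat i" using that by auto
    have "e (- int (nat i)) (cl N 0 cyclic_vec) = 0"
      unfolding e_cl[OF N cyc]
      using current_e_filt_drop[OF cyc i(2)] by (intro cl_zero[OF N]) simp
    then show ?thesis using i by simp
  qed
  show "h (- i) (cl N 0 cyclic_vec) = 0" if "i > 0" for i
  proof -
    have i: "i = int (nat i)" "nat i > 0" using that by auto
    have "h (- int (nat i)) (cl N 0 cyclic_vec) = 0"
      unfolding h_cl[OF N cyc] current_h_cyclic
      using i(2) by (intro cl_zero[OF N] filt_scale cyclic_in_filt) simp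
    then show ?thesis using i by simp
  qed
  show "h 0 (cl N 0 cyclic_vec) = sc (- of_int (int N)) (cl N 0 cyclic_vec)"
  proof -
    have "current (z N) N Hsl 0 cyclic_vec = fscale (- of_nat N) cyclic_vec"
      by (simp add: current_h_cyclic)
    from h_cl[OF N cyc, of 0, unfolded this] cl_scale[OF N cyc, of "- of_nat N"]
    show ?thesis by (simp del: fv.scale_minus_left)
  qed
qed

lemma descendant_induct:
  assumes N: "even N" and base: "P 0 (cl N 0 cyclic_vec)"
    and step: "\<And>s v i. P s v \<Longrightarrow> P (s + i) (e (- int i) v)"
  shows "P (sum_list js) (cl N (sum_list js) (foldr (current (z N) N Esl) js cyclic_vec))"
proof (induction js)
  case Nil
  then show ?case using base by simp
next
  case (Cons i js)
  let ?v = "foldr (current (z N) N Esl) js cyclic_vec"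
  have "?v \<in> filt (z N) N (int (sum_list js))" by (rule filt_gen) simp
  from e_cl[OF N this, of i] step[OF Cons, of i] show ?case by (simp add: add.commute)
qed

text \<open>Among the monomials spanning a step of the filtration, those of degree less than \<open>m\<close> have class zero in
degree \<open>m\<close>, so only those of degree exactly \<open>m\<close> matter.\<close>

lemma homogeneous_in_subspace:
  assumes N: "even N" and U: "subspace U"
    and gen: "\<And>js. sum_list js = m \<Longrightarrow> cl N m (foldr (current (z N) N Esl) js cyclic_vec) \<in> U"
    and v: "v \<in> filt (z N) N (int m)"
  shows "cl N m v \<in> U"
  using v
proof (induction rule: filt_induct)
  case (gen js)
  show ?case
  proof (cases "sum_list js = m")
    case True
    then show ?thesis by (rule assms(3))
  next
    case False
    then have "foldr (current (z N) N Esl) js cyclic_vec \<in> filt (z N) N (int m - 1)"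
      using gen by (intro filt_gen) linarith
    then show ?thesis using cl_zero[OF N] subspace_0[OF U] by simp
  qed
next
  case zero
  then show ?case using cl_zero[OF N, of 0 m] subspace_0[OF U] by simp
next
  case (add u w)
  then show ?case using cl_add[OF N] subspace_add[OF U] by simp
next
  case (scale c u)
  then show ?case using cl_scale[OF N] subspace_scale[OF U] by simp
qed

lemma lowest_weight_vectors_generate:
  assumes U: "subspace U" and vac: "\<And>N. even N \<Longrightarrow> cl N 0 cyclic_vec \<in> U"
    and e: "\<And>v i. v \<in> U \<Longrightarrow> e (- int i) v \<in> U"
  shows "v \<in> U"
proof -
  obtain N \<phi> where N: "even N" and \<phi>: "\<phi> \<in> fusion (z N) N" and v: "v = \<iota> N \<phi>" by (rule iota_covers)
  have "\<iota> N \<phi> \<in> U"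
    using \<phi>
  proof (induction rule: fusion_induct)
    case (homogeneous m v)
    show ?case
    proof (rule homogeneous_in_subspace[OF N U _ homogeneous])
      fix js :: "nat list" assume "sum_list js = m"
      then show "cl N m (foldr (current (z N) N Esl) js cyclic_vec) \<in> U"
        using descendant_induct[OF N, of "\<lambda>_ v. v \<in> U" js] vac[OF N] e by simp
    qed
  next
    case (add \<phi> \<psi>)
    then show ?case using iota_add[OF N] subspace_add[OF U] by simp
  qed
  then show ?thesis by (simp add: v)
qed

lemma all_smooth: "smooth v"
proof -
  have "v \<in> {v. smooth v}"
    by (rule lowest_weight_vectors_generate) (auto simp: subspace_smooth smooth_e intro: extremal_smooth[OF lowest_weight_vector_extremal])
  then show ?thesis by simp
qed

text \<open>The vectors killed by the square of \<open>e(x)\<close> form a subspace that contains all \<open>v\<^sub>N\<close> and is stable under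
\<open>e\<close>.\<close>

lemma all_e_square_null: "e_square_null v"
proof -
  have "v \<in> {v. e_square_null v}"
    by (rule lowest_weight_vectors_generate)
      (auto simp: subspace_e_square_null e_square_null_e intro: extremal_e_square_null[OF lowest_weight_vector_extremal])
  then show ?thesis by simp
qed

lemma L0_homogeneous:
  assumes N: "even N" and v: "v \<in> filt (z N) N (int m)"
  shows "L0 (cl N m v) = sc ((of_nat N)\<^sup>2 / 4 - of_nat m) (cl N m v)"
proof -
  let ?c = "\<lambda>m. (of_nat N)\<^sup>2 / 4 - of_nat m :: complex"
  have "cl N m v \<in> {u. L0 u = sc (?c m) u}"
  proof (rule homogeneous_in_subspace[OF N _ _ v])
    show "subspace {u. L0 u = sc (?c m) u}"
    proof (rule subspaceI)
      show "0 \<in> {u. L0 u = sc (?c m) u}" using L0_scale[OF all_smooth, of 0 0] by simp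
    next
      fix x y assume "x \<in> {u. L0 u = sc (?c m) u}" "y \<in> {u. L0 u = sc (?c m) u}"
      then show "x + y \<in> {u. L0 u = sc (?c m) u}"
        by (simp only: mem_Collect_eq L0_add[OF all_smooth all_smooth] scale_right_distrib)
    next
      fix c x assume "x \<in> {u. L0 u = sc (?c m) u}"
      then show "sc c x \<in> {u. L0 u = sc (?c m) u}"
        by (simp only: mem_Collect_eq L0_scale[OF all_smooth] scale_left_commute)
    qed
    fix js :: "nat list" assume js: "sum_list js = m"
    have "L0 (cl N (sum_list js) (foldr (current (z N) N Esl) js cyclic_vec))
      = sc (?c (sum_list js)) (cl N (sum_list js) (foldr (current (z N) N Esl) js cyclic_vec))"
    proof (rule descendant_induct[OF N, of "\<lambda>m u. L0 u = sc (?c m) u"])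
      show "L0 (cl N 0 cyclic_vec) = sc (?c 0) (cl N 0 cyclic_vec)"
        using L0_extremal[OF lowest_weight_vector_extremal[OF N]] by (simp add: power2_eq_square)
      fix s v i assume *: "L0 v = sc (?c s) v"
      have "L0 (e (- int i) v) = e (- int i) (L0 v) + sc (of_int (- int i)) (e (- int i) v)"
        by (rule L0_e[OF all_e_square_null all_smooth])
      also have "\<dots> = sc (?c s + of_int (- int i)) (e (- int i) v)"
        by (simp only: * act_scale scale_left_distrib)
      also have "?c s + of_int (- int i) = ?c (s + i)" by simp
      finally show "L0 (e (- int i) v) = sc (?c (s + i)) (e (- int i) v)" .
    qed
    then show "cl N m (foldr (current (z N) N Esl) js cyclic_vec) \<in> {u. L0 u = sc (?c m) u}"
      using js by simp
  qed
  then show ?thesis by simp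
qed

section \<open>Transport to the tableau space\<close>

text \<open>Multiplication by \<open>n\<^sup>2 - maj\<close> for \<open>N = 2n\<close>.\<close>

definition energy :: "nat \<Rightarrow> tab_space \<Rightarrow> tab_space" where
  "energy N = diag_op (\<lambda>(i, \<tau>). (of_nat N)\<^sup>2 / 4 - of_nat (maj \<tau>))"

lemma energy_graded:
  assumes "y \<in> X_graded N m"
  shows "energy N y = fscale ((of_nat N)\<^sup>2 / 4 - of_nat m) y"
proof (rule poly_mapping_eqI)
  fix a
  show "Poly_Mapping.lookup (energy N y) a
      = Poly_Mapping.lookup (fscale ((of_nat N)\<^sup>2 / 4 - of_nat m) y) a"
  proof (cases "a \<in> Poly_Mapping.keys y")
    case True
    then have "maj (snd a) = m" using assms by (auto simp: X_graded_def)
    then show ?thesis by (simp add: energy_def case_prod_beta)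
  qed (simp add: energy_def in_keys_iff)
qed

lemma R_linear:
  assumes "even N" "\<phi> \<in> fusion (z N) N"
  shows "\<psi> \<in> fusion (z N) N \<Longrightarrow> R N (fusion_add \<phi> \<psi>) = R N \<phi> + R N \<psi>"
    "R N (fusion_scale (z N) N c \<phi>) = fscale c (R N \<phi>)"
  using isos[OF assms(1)] assms(2) unfolding graded_unitary_iso_def fusion_linear_def by blast+

lemma R_bij: "even N \<Longrightarrow> bij_betw (R N) (fusion (z N) N) (X_space N)"
  using isos unfolding graded_unitary_iso_def by blast

text \<open>On a homogeneous component, \<open>L0\<close> is the scalar of \<open>L0_homogeneous\<close>, and \<open>R N\<close> sends this component to
tableaux on which \<open>energy N\<close> is the same scalar.\<close>

lemma L0_finite_level:
  assumes N: "even N" and \<phi>: "\<phi> \<in> fusion (z N) N"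
  shows "\<exists>\<phi>'\<in>fusion (z N) N. \<iota> N \<phi>' = L0 (\<iota> N \<phi>) \<and> R N \<phi>' = energy N (R N \<phi>)"
  using \<phi>
proof (induction rule: fusion_induct)
  case (homogeneous m v)
  let ?c = "(of_nat N)\<^sup>2 / 4 - of_nat m :: complex" and ?\<phi> = "fusion_class (z N) N m v"
  note in_f = fusion_class_in[OF homogeneous]
  have "?\<phi> \<in> fusion_piece (z N) N m" using homogeneous by (auto simp: fusion_piece_def)
  then have "R N ?\<phi> \<in> X_graded N m" using isos[OF N] unfolding graded_unitary_iso_def by blast
  then have "R N (fusion_scale (z N) N ?c ?\<phi>) = energy N (R N ?\<phi>)"
    by (simp only: energy_graded R_linear(2)[OF N in_f])
  moreover have "\<iota> N (fusion_scale (z N) N ?c ?\<phi>) = L0 (\<iota> N ?\<phi>)"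
    by (simp only: iota_scale[OF N in_f] L0_homogeneous[OF N homogeneous])
  ultimately show ?case using fusion_scale_in[OF in_f] by blast
next
  case (add \<phi> \<psi>)
  from add.IH obtain \<phi>' \<psi>' where
    1: "\<phi>' \<in> fusion (z N) N" "\<iota> N \<phi>' = L0 (\<iota> N \<phi>)" "R N \<phi>' = energy N (R N \<phi>)" and
    2: "\<psi>' \<in> fusion (z N) N" "\<iota> N \<psi>' = L0 (\<iota> N \<psi>)" "R N \<psi>' = energy N (R N \<psi>)" by blast
  have "\<iota> N (fusion_add \<phi>' \<psi>') = L0 (\<iota> N (fusion_add \<phi> \<psi>))"
    by (simp only: iota_add[OF N 1(1) 2(1)] iota_add[OF N add.hyps] 1 2 L0_add[OF all_smooth all_smooth])
  moreover have "R N (fusion_add \<phi>' \<psi>') = energy N (R N (fusion_add \<phi> \<psi>))"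
    by (simp only: R_linear(1)[OF N 1(1) 2(1)] R_linear(1)[OF N add.hyps] 1 2 energy_def diag_op_add)
  ultimately show ?case using fusion_add_in[OF 1(1) 2(1)] by blast
qed

lemma X_to_limit_eq: "X_to_limit N = lin_ext (\<lambda>a. basis_vec (case a of (i, \<tau>) \<Rightarrow> (i, add_inf N \<tau>)))"
  unfolding X_to_limit_def by (rule arg_cong[of _ _ lin_ext]) (auto simp: fun_eq_iff)

lemma inj_on_X_to_limit:
  assumes N: "even N"
  shows "inj_on (X_to_limit N) (X_space N)"
proof (rule inj_onI)
  fix y y' assume y: "y \<in> X_space N" "y' \<in> X_space N" and eq: "X_to_limit N y = X_to_limit N y'"
  define D where "D = {(i :: nat, \<tau>). \<exists>k\<le>N div 2. \<tau> \<in> SYT (N div 2 + k) (N div 2 - k)}"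
  have "subtableau (add_inf N \<tau>) N = \<tau>" if "(i, \<tau>) \<in> D" for i \<tau>
    using that N by (auto simp: D_def intro!: subtableau_add_inf)
  then have "inj_on (\<lambda>(i, \<tau>). (i, add_inf N \<tau>)) D"
    by (intro inj_onI) (clarsimp, metis)
  note lk = lookup_relabelled[OF this]
  have D: "Poly_Mapping.keys y \<subseteq> D" "Poly_Mapping.keys y' \<subseteq> D"
    using y by (auto simp: X_space_def D_def)
  show "y = y'"
  proof (rule poly_mapping_eqI)
    fix a
    show "Poly_Mapping.lookup y a = Poly_Mapping.lookup y' a"
    proof (cases "a \<in> D")
      case True
      then show ?thesis using lk[OF D(1) True] lk[OF D(2) True] eq by (simp only: X_to_limit_eq)
    next
      case False
      then have "a \<notin> Poly_Mapping.keys y" "a \<notin> Poly_Mapping.keys y'" using D by auto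
      then show ?thesis by (simp add: in_keys_iff)
    qed
  qed
qed

lemma inj_rho: "inj \<rho>"
proof (rule injI)
  fix v w assume eq: "\<rho> v = \<rho> w"
  obtain N \<phi> \<psi> where N: "even N" and *: "\<phi> \<in> fusion (z N) N" "\<psi> \<in> fusion (z N) N" "v = \<iota> N \<phi>" "w = \<iota> N \<psi>"
    by (rule iota_covers_pair)
  have "X_to_limit N (R N \<phi>) = X_to_limit N (R N \<psi>)"
    using eq limit_iso[OF N] * by simp
  moreover have "R N \<phi> \<in> X_space N" "R N \<psi> \<in> X_space N"
    using R_bij[OF N] * bij_betwE by blast+
  ultimately have "R N \<phi> = R N \<psi>" using inj_on_X_to_limit[OF N] by (meson inj_onD)
  then have "\<phi> = \<psi>" using R_bij[OF N] * by (meson bij_betw_def inj_onD)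
  then show "v = w" using * by simp
qed

lemma rho_add: "\<rho> (v + w) = \<rho> v + \<rho> w"
proof -
  obtain N \<phi> \<psi> where N: "even N" and *: "\<phi> \<in> fusion (z N) N" "\<psi> \<in> fusion (z N) N" "v = \<iota> N \<phi>" "w = \<iota> N \<psi>"
    by (rule iota_covers_pair)
  have "\<rho> (v + w) = X_to_limit N (R N (fusion_add \<phi> \<psi>))"
    using limit_iso[OF N fusion_add_in[OF *(1,2)]] iota_add[OF N *(1,2)] * by simp
  then show ?thesis
    using limit_iso[OF N] * R_linear(1)[OF N *(1,2)] by (simp add: X_to_limit_def lin_ext_add)
qed

lemma rho_scale: "\<rho> (sc c v) = fscale c (\<rho> v)"
proof -
  obtain N \<phi> where N: "even N" and *: "\<phi> \<in> fusion (z N) N" "v = \<iota> N \<phi>" by (rule iota_covers)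
  have "\<rho> (sc c v) = X_to_limit N (R N (fusion_scale (z N) N c \<phi>))"
    using limit_iso[OF N fusion_scale_in[OF *(1)]] iota_scale[OF N *(1)] * by simp
  then show ?thesis
    using limit_iso[OF N *(1)] * R_linear(2)[OF N *(1)] by (simp add: X_to_limit_def lin_ext_scale)
qed

lemma transport_rho: "transport \<rho> A (\<rho> v) = \<rho> (A v)"
  by (simp add: transport_def inv_f_f[OF inj_rho])

text \<open>A basis vector of the limit space is already the image of one at a finite level, where
\<open>L0_finite_level\<close> applies and \<open>n\<^sup>2 - maj\<close> equals the stable major index.\<close>

lemma rho_hits_basis_vec:
  assumes \<tau>: "\<tau> \<in> tail_tableaux k" and i: "i < 2 * k + 1"
  obtains v where "\<rho> v = basis_vec (i, \<tau>)" "\<rho> (L0 v) = fscale (of_real (stable_maj \<tau>)) (basis_vec (i, \<tau>))"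
proof -
  obtain n where "n \<ge> k" and syt: "subtableau \<tau> (2 * n) \<in> SYT (n + k) (n - k)"
    and add: "add_inf (2 * n) (subtableau \<tau> (2 * n)) = \<tau>"
    and r: "(real n)\<^sup>2 - real (maj (subtableau \<tau> (2 * n))) = stable_maj \<tau>"
    using tail_tableau_stabilises[OF \<tau>] by (metis order_refl)
  define N where "N = 2 * n"
  define s where "s = subtableau \<tau> N"
  have N: "even N" by (simp add: N_def)
  have "basis_vec (i, s) \<in> X_space N"
    using syt i \<open>n \<ge> k\<close> by (auto simp: X_space_def N_def s_def)
  then obtain \<phi> where \<phi>: "\<phi> \<in> fusion (z N) N" "R N \<phi> = basis_vec (i, s)"
    using R_bij[OF N] by (metis bij_betw_imp_surj_on imageE)
  obtain \<phi>' where \<phi>': "\<phi>' \<in> fusion (z N) N" "\<iota> N \<phi>' = L0 (\<iota> N \<phi>)" "R N \<phi>' = energy N (R N \<phi>)"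
    using L0_finite_level[OF N \<phi>(1)] by blast
  have X: "X_to_limit N (basis_vec (i, s)) = basis_vec (i, \<tau>)"
    using add by (simp add: X_to_limit_def s_def N_def)
  have "\<rho> (\<iota> N \<phi>) = basis_vec (i, \<tau>)" using limit_iso[OF N \<phi>(1)] \<phi>(2) X by simp
  moreover have "\<rho> (L0 (\<iota> N \<phi>)) = fscale (of_real (stable_maj \<tau>)) (basis_vec (i, \<tau>))"
  proof -
    have c: "(of_nat N)\<^sup>2 / 4 - of_nat (maj s) = complex_of_real (stable_maj \<tau>)"
      by (simp add: r[symmetric] N_def s_def power_mult_distrib)
    have "\<rho> (L0 (\<iota> N \<phi>)) = X_to_limit N (energy N (basis_vec (i, s)))"
      using limit_iso[OF N \<phi>'(1)] \<phi>' \<phi> by simp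
    also have "energy N (basis_vec (i, s)) = fscale (of_real (stable_maj \<tau>)) (basis_vec (i, s))"
      by (simp add: energy_def diag_op_def c)
    finally show ?thesis using X by (simp add: X_to_limit_def lin_ext_scale del: fscale_single lin_ext_single)
  qed
  ultimately show ?thesis by (rule that)
qed

text \<open>The inverse of \<open>\<rho>\<close> in \<open>transport\<close> is meaningful only on the range of \<open>\<rho>\<close>. The set \<open>?U\<close> of vectors in
this range for which the formula holds is a subspace and contains the basis vectors, so it contains \<open>y\<close>.\<close>

lemma transport_L0:
  assumes "Poly_Mapping.keys y \<subseteq> {..<2 * k + 1} \<times> tail_tableaux k"
  shows "transport \<rho> L0 y = diag_op (\<lambda>(i, \<tau>). of_real (stable_maj \<tau>)) y"
proof -
  let ?d = "diag_op (\<lambda>(i :: nat, \<tau>). complex_of_real (stable_maj \<tau>))"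
  let ?U = "{y. \<exists>v. \<rho> v = y \<and> \<rho> (L0 v) = ?d y}"
  have "fv.subspace ?U"
  proof (rule fv.subspaceI)
    have "\<rho> 0 = 0" using rho_scale[of 0 0] by simp
    moreover have "L0 0 = 0" using L0_scale[OF all_smooth, of 0 0] by simp
    ultimately show "0 \<in> ?U" by (auto simp: diag_op_def intro!: exI[of _ 0])
  next
    fix x y assume "x \<in> ?U" "y \<in> ?U"
    then obtain v w where "\<rho> v = x" "\<rho> (L0 v) = ?d x" "\<rho> w = y" "\<rho> (L0 w) = ?d y" by blast
    then have "\<rho> (v + w) = x + y" "\<rho> (L0 (v + w)) = ?d (x + y)"
      by (simp_all only: rho_add L0_add[OF all_smooth all_smooth] diag_op_add)
    then show "x + y \<in> ?U" by blast
  next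
    fix c x assume "x \<in> ?U"
    then obtain v where "\<rho> v = x" "\<rho> (L0 v) = ?d x" by blast
    then have "\<rho> (sc c v) = fscale c x" "\<rho> (L0 (sc c v)) = ?d (fscale c x)"
      by (simp_all only: rho_scale L0_scale[OF all_smooth] diag_op_scale)
    then show "fscale c x \<in> ?U" by blast
  qed
  moreover have "basis_vec a \<in> ?U" if "a \<in> Poly_Mapping.keys y" for a
  proof -
    have "a \<in> {..<2 * k + 1} \<times> tail_tableaux k" using assms that by (rule subsetD)
    then obtain i \<tau> where a: "a = (i, \<tau>)" "i < 2 * k + 1" "\<tau> \<in> tail_tableaux k" by auto
    obtain v where "\<rho> v = basis_vec a" "\<rho> (L0 v) = fscale (of_real (stable_maj \<tau>)) (basis_vec a)"
      using rho_hits_basis_vec[OF a(3,2)] unfolding a(1) by blast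
    moreover have "?d (basis_vec a) = fscale (of_real (stable_maj \<tau>)) (basis_vec a)"
      by (simp add: diag_op_def a(1))
    ultimately show ?thesis by (simp only: mem_Collect_eq) blast
  qed
  ultimately have "(\<Sum>a\<in>Poly_Mapping.keys y. fscale (Poly_Mapping.lookup y a) (basis_vec a)) \<in> ?U"
    by (intro fv.subspace_sum fv.subspace_scale) blast+
  then have "y \<in> ?U" by (simp only: basis_expansion[of y, symmetric])
  then obtain v where v: "\<rho> v = y" "\<rho> (L0 v) = ?d y" by blast
  show ?thesis using transport_rho[of L0 v] unfolding v .
qed

text \<open>Testing against the lowest weight vector of the finite-dimensional factor shows that the operator
on the multiplicity space is unique.\<close>

lemma Pi_op_L0:
  assumes w: "w \<in> Pi_space k"
  shows "Pi_op k (transport \<rho> L0) w = diag_op (\<lambda>\<tau>. of_real (stable_maj \<tau>)) w" (is "_ = ?d w")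
    and "x \<in> irr_space (2 * k + 1) \<Longrightarrow> transport \<rho> L0 (x \<otimes>\<^sub>v w) = x \<otimes>\<^sub>v diag_op (\<lambda>\<tau>. of_real (stable_maj \<tau>)) w"
    and "diag_op (\<lambda>\<tau>. of_real (stable_maj \<tau>)) w \<in> Pi_space k"
proof -
  have d: "?d w \<in> Pi_space k" using keys_diag_op w by (fastforce simp: Pi_space_def)
  have tr: "transport \<rho> L0 (x \<otimes>\<^sub>v w) = x \<otimes>\<^sub>v ?d w" if "x \<in> irr_space (2 * k + 1)" for x
  proof -
    have "Poly_Mapping.keys (x \<otimes>\<^sub>v w) \<subseteq> {..<2 * k + 1} \<times> tail_tableaux k"
      using keys_tensor[of x w] that w by (auto simp: irr_space_def Pi_space_def)
    then show ?thesis by (simp only: transport_L0 tensor_diag_op)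
  qed
  have u0: "basis_vec 0 \<in> irr_space (2 * k + 1)" by (simp add: irr_space_def)
  show "Pi_op k (transport \<rho> L0) w = ?d w"
    unfolding Pi_op_def
  proof (rule the_equality)
    show "?d w \<in> Pi_space k \<and> (\<forall>x\<in>irr_space (2 * k + 1). transport \<rho> L0 (x \<otimes>\<^sub>v w) = x \<otimes>\<^sub>v ?d w)"
      using d tr by blast
  next
    fix w' assume "w' \<in> Pi_space k \<and> (\<forall>x\<in>irr_space (2 * k + 1). transport \<rho> L0 (x \<otimes>\<^sub>v w) = x \<otimes>\<^sub>v w')"
    then have eq: "basis_vec 0 \<otimes>\<^sub>v w' = basis_vec (0 :: nat) \<otimes>\<^sub>v ?d w" using tr u0 by metis
    show "w' = ?d w"
    proof (rule poly_mapping_eqI)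
      fix b
      show "Poly_Mapping.lookup w' b = Poly_Mapping.lookup (?d w) b"
        using arg_cong[OF eq, of "\<lambda>y. Poly_Mapping.lookup y (0, b)"] by (simp add: lookup_single)
    qed
  qed
  show "x \<in> irr_space (2 * k + 1) \<Longrightarrow> transport \<rho> L0 (x \<otimes>\<^sub>v w) = x \<otimes>\<^sub>v ?d w" by (rule tr)
  show "?d w \<in> Pi_space k" by (rule d)
qed

end

theorem corollary3:
  fixes z :: "nat \<Rightarrow> nat \<Rightarrow> complex"
    and j :: "nat \<Rightarrow> fusion_vec \<Rightarrow> fusion_vec"
    and sc :: "complex \<Rightarrow> 'v::ab_group_add \<Rightarrow> 'v"
    and \<iota> :: "nat \<Rightarrow> fusion_vec \<Rightarrow> 'v"
    and act :: "sl2 \<Rightarrow> int \<Rightarrow> 'v \<Rightarrow> 'v"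
    and ip :: "'v \<Rightarrow> 'v \<Rightarrow> complex"
    and R :: "nat \<Rightarrow> fusion_vec \<Rightarrow> tab_space"
    and \<rho> :: "'v \<Rightarrow> tab_space"
    and k :: nat
  assumes points_distinct: "\<And>N. even N \<Longrightarrow> inj_on (z N) {..<N}"
    and embeddings: "\<And>N. even N \<Longrightarrow> fusion_embedding z N (j N)"
    and limit: "is_fusion_limit z j sc \<iota>"
    and basic: "basic_rep sc act (\<iota> 0 (fusion_vac (z 0) 0))"
    and action_extends: "\<And>N x i \<phi>. even N \<Longrightarrow> \<phi> \<in> fusion (z N) N \<Longrightarrow>
          \<iota> N (fusion_act (z N) N x i \<phi>) = act x (- int i) (\<iota> N \<phi>)"
    and form: "pos_def_hermitian sc ip" "contravariant_form act ip"
    and vacuum_norm: "ip (\<iota> 0 (fusion_vac (z 0) 0)) (\<iota> 0 (fusion_vac (z 0) 0)) = 1"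
    and isos: "\<And>N. even N \<Longrightarrow> graded_unitary_iso (z N) N (\<iota> N) ip (R N)"
    and isos_compatible: "\<And>N \<phi>. even N \<Longrightarrow> \<phi> \<in> fusion (z N) N \<Longrightarrow>
          R (N + 2) (j N \<phi>) = X_step N (R N \<phi>)"
    and limit_iso: "\<And>N \<phi>. even N \<Longrightarrow> \<phi> \<in> fusion (z N) N \<Longrightarrow>
          \<rho> (\<iota> N \<phi>) = X_to_limit N (R N \<phi>)"
  shows "acts_as_id_tensor k (transport \<rho> (vir sc act 0)) (Pi_op k (transport \<rho> (vir sc act 0))) \<and>
         fv.independent (basis_vec ` tail_tableaux k) \<and>
         fv.span (basis_vec ` tail_tableaux k) = Pi_space k \<and>
         (\<forall>\<tau>\<in>tail_tableaux k. Pi_op k (transport \<rho> (vir sc act 0)) (basis_vec \<tau>)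
            = fscale (of_real (stable_maj \<tau>)) (basis_vec \<tau>))"
proof -
  interpret unitary_level_one sc act ip
  proof (intro unitary_level_one.intro unitary_level_one_axioms.intro)
    show "vector_space sc" using limit unfolding is_fusion_limit_def by blast
    show "affine_sl2_rep sc 1 act" using basic unfolding basic_rep_def by blast
  qed (fact form)+
  interpret fusion_limit sc act ip z j \<iota> R \<rho>
    by unfold_locales (fact embeddings limit action_extends isos limit_iso)+
  note Pi = Pi_op_L0[of _ k, unfolded L0_def]
  have "acts_as_id_tensor k (transport \<rho> (vir sc act 0)) (Pi_op k (transport \<rho> (vir sc act 0)))"
    unfolding acts_as_id_tensor_def by (auto simp: Pi)
  moreover have "Pi_op k (transport \<rho> (vir sc act 0)) (basis_vec \<tau>)
      = fscale (of_real (stable_maj \<tau>)) (basis_vec \<tau>)" if "\<tau> \<in> tail_tableaux k" for \<tau>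
  proof -
    have "basis_vec \<tau> \<in> Pi_space k" using that by (simp add: Pi_space_def)
    from Pi(1)[OF this] show ?thesis by (simp add: diag_op_def)
  qed
  ultimately show ?thesis using independent_basis_vec span_basis_vec_tail by blast
qed

end
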